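(* Let $M$ be a compact embedded surface in $\mathrm{Sol}$ whose boundary $\Gamma$ is a closed curve lying in the plane $P=\{(0,y,z):y,z\in\mathbb{R}\}$. Denote by $D\subset P$ the bounded domain determined by $\Gamma$ in $P$. Assume that (1) the mean curvature function $H$ of $M$ does not vanish; and (2) $M$ does not intersect $\mathrm{ext}(D)$. Then $M$ lies in one of the half-spaces of $\mathbb{R}^3$ determined by $P$, i.e. $M\subset\{x\ge 0\}$ or $M\subset\{x\le 0\}$. The analogous result holds with $P$ replaced by $R=\{(x,y,0):x,y\in\mathbb{R}\}$: if $\Gamma=\partial M\subset R$, $D\subset R$ is the bounded domain determined by $\Gamma$ in $R$, the mean curvature function of $M$ does not vanish and $M$ does not intersect $\mathrm{ext}(D)$, then $M\subset\{z\ge 0\}$ or $M\subset\{z\le 0\}$.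
   Context: $\mathrm{Sol}$ is $\mathbb{R}^3$ with canonical coordinates $(x,y,z)$ and the Riemannian metric $e^{2z}dx^2+e^{-2z}dy^2+dz^2$. Here $M$ is not assumed to have constant mean curvature. For a bounded domain $D$ of the plane $P$ (resp. $R$), $\mathrm{ext}(D)$ denotes the exterior of $D$ in that plane, i.e. $P\setminus\overline{D}$ (resp. $R\setminus\overline{D}$).
   Formalization: The surface M is additionally assumed connected; otherwise a small closed sphere of non-vanishing mean curvature placed on the other side of the plane from a spherical cap would be a counterexample. *)

theory Defs
  imports "HOL-Analysis.Analysis"
begin

text \<open>Points of \<open>Sol\<close> are vectors of \<open>real^3\<close> with coordinates
  \<open>x = p$1\<close>, \<open>y = p$2\<close>, \<open>z = p$3\<close>; tangent vectors are written in the
  coordinate frame, so the tangent space at every point is again \<open>real^3\<close>.\<close>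

definition sol_metric :: "real^3 \<Rightarrow> real^3 \<Rightarrow> real^3 \<Rightarrow> real" where
  "sol_metric p u v = exp (2 * p$3) * u$1 * v$1 + exp (- 2 * p$3) * u$2 * v$2 + u$3 * v$3"


subsection \<open>Levi-Civita connection\<close>

definition sol_gram :: "real^3 \<Rightarrow> real^3^3" where
  "sol_gram p = (\<chi> i j. sol_metric p (axis i 1) (axis j 1))"

definition sol_gram_deriv :: "real^3 \<Rightarrow> 3 \<Rightarrow> 3 \<Rightarrow> 3 \<Rightarrow> real" where
  "sol_gram_deriv p l i j = frechet_derivative (\<lambda>q. sol_gram q $ i $ j) (at p) (axis l 1)"

definition sol_christoffel :: "real^3 \<Rightarrow> 3 \<Rightarrow> 3 \<Rightarrow> 3 \<Rightarrow> real" where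
  "sol_christoffel p k i j =
     (\<Sum>l\<in>UNIV. matrix_inv (sol_gram p) $ k $ l *
        (sol_gram_deriv p i j l + sol_gram_deriv p j i l - sol_gram_deriv p l i j)) / 2"

definition sol_covariant_deriv :: "(real^3 \<Rightarrow> real^3) \<Rightarrow> real^3 \<Rightarrow> real^3 \<Rightarrow> real^3" where
  "sol_covariant_deriv X p v =
     frechet_derivative X (at p) v +
     (\<chi> k. \<Sum>i\<in>UNIV. \<Sum>j\<in>UNIV. sol_christoffel p k i j * v$i * X p $ j)"


subsection \<open>Embedded surfaces with boundary\<close>

text \<open>Only meant for open \<open>U\<close> in a finite-dimensional space, where continuity of all
  directional derivatives of order at most \<open>k\<close> is the usual class \<open>C^k\<close>.\<close>

primrec Ck_on :: "nat \<Rightarrow> 'a::real_normed_vector set \<Rightarrow> ('a \<Rightarrow> 'b::real_normed_vector) \<Rightarrow> bool" where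
  "Ck_on 0 U f \<longleftrightarrow> continuous_on U f"
| "Ck_on (Suc k) U f \<longleftrightarrow>
     (\<forall>x\<in>U. f differentiable (at x)) \<and>
     (\<forall>v. Ck_on k U (\<lambda>x. frechet_derivative f (at x) v))"

definition smooth_on :: "'a::real_normed_vector set \<Rightarrow> ('a \<Rightarrow> 'b::real_normed_vector) \<Rightarrow> bool" where
  "smooth_on U f \<longleftrightarrow> (\<forall>k. Ck_on k U f)"

definition flat_model :: "(real^3) set" where
  "flat_model = {y. y$3 = 0}"

definition half_model :: "(real^3) set" where
  "half_model = {y. y$3 = 0 \<and> y$2 \<ge> 0}"

text \<open>A diffeomorphism \<open>\<phi>\<close>, with inverse \<open>\<psi>\<close>, between open subsets \<open>U\<close> and \<open>V\<close> of the
  ambient space that straightens \<open>M\<close> to the model \<open>S\<close>.\<close>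

definition slice_chart ::
  "(real^3) set \<Rightarrow> (real^3) set \<Rightarrow> (real^3) set \<Rightarrow> (real^3) set \<Rightarrow>
   (real^3 \<Rightarrow> real^3) \<Rightarrow> (real^3 \<Rightarrow> real^3) \<Rightarrow> bool" where
  "slice_chart M S U V \<phi> \<psi> \<longleftrightarrow>
     open U \<and> open V \<and> homeomorphism U V \<phi> \<psi> \<and> smooth_on U \<phi> \<and> smooth_on V \<psi> \<and>
     \<phi> ` (M \<inter> U) = V \<inter> S"

definition surface_interior :: "(real^3) set \<Rightarrow> (real^3) set" where
  "surface_interior M =
     {p \<in> M. \<exists>U V \<phi> \<psi>. p \<in> U \<and> slice_chart M flat_model U V \<phi> \<psi>}"

definition surface_boundary :: "(real^3) set \<Rightarrow> (real^3) set" where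
  "surface_boundary M =
     {p \<in> M. \<exists>U V \<phi> \<psi>. p \<in> U \<and> slice_chart M half_model U V \<phi> \<psi> \<and> \<phi> p $ 2 = 0}"

definition embedded_surface :: "(real^3) set \<Rightarrow> bool" where
  "embedded_surface M \<longleftrightarrow> M = surface_interior M \<union> surface_boundary M"

text \<open>At a boundary point this is the full tangent plane, not the half-plane of inward
  directions.\<close>

definition surface_tangent :: "(real^3) set \<Rightarrow> real^3 \<Rightarrow> (real^3) set" where
  "surface_tangent M p =
     {v. \<exists>S\<in>{flat_model, half_model}. \<exists>U V \<phi> \<psi>.
        p \<in> U \<and> slice_chart M S U V \<phi> \<psi> \<and> frechet_derivative \<phi> (at p) v $ 3 = 0}"


subsection \<open>Mean curvature\<close>

text \<open>A unit normal field of \<open>M\<close> along \<open>M \<inter> W\<close>. It is given with a smooth extension to the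
  open set \<open>W\<close>, so that it can be differentiated at boundary points as well; the values off
  \<open>M\<close> are arbitrary and do not influence the derivative in tangential directions.\<close>

definition sol_unit_normal_on ::
  "(real^3) set \<Rightarrow> (real^3) set \<Rightarrow> (real^3 \<Rightarrow> real^3) \<Rightarrow> bool" where
  "sol_unit_normal_on M W N \<longleftrightarrow>
     open W \<and> smooth_on W N \<and>
     (\<forall>q\<in>M \<inter> W. sol_metric q (N q) (N q) = 1 \<and>
        (\<forall>v\<in>surface_tangent M q. sol_metric q (N q) v = 0))"

definition sol_shape_operator :: "(real^3 \<Rightarrow> real^3) \<Rightarrow> real^3 \<Rightarrow> real^3 \<Rightarrow> real^3" where
  "sol_shape_operator N p v = - sol_covariant_deriv N p v"

text \<open>The mean curvature is half the trace of the shape operator \<open>A\<close> as an endomorphism of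
  the tangent plane \<open>T\<close>. Since \<open>A\<close> maps \<open>T\<close> to itself, this trace equals the trace on
  \<open>real^3\<close> of \<open>A\<close> composed with the orthogonal projection \<open>v - g(v,N) N\<close> onto \<open>T\<close>.\<close>

definition sol_mean_curvature :: "(real^3 \<Rightarrow> real^3) \<Rightarrow> real^3 \<Rightarrow> real" where
  "sol_mean_curvature N p =
     trace (matrix (\<lambda>v. sol_shape_operator N p (v - sol_metric p v (N p) *\<^sub>R N p))) / 2"

text \<open>A unit normal at \<open>p\<close> is unique up to sign, and replacing \<open>N\<close> by \<open>- N\<close> changes the sign
  of the mean curvature. So its non-vanishing at \<open>p\<close> does not depend on the local unit normal
  field, and no global orientation of \<open>M\<close> has to be chosen.\<close>

definition nonvanishing_mean_curvature :: "(real^3) set \<Rightarrow> bool" where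
  "nonvanishing_mean_curvature M \<longleftrightarrow>
     (\<forall>p\<in>M. \<exists>W N. p \<in> W \<and> sol_unit_normal_on M W N \<and> sol_mean_curvature N p \<noteq> 0)"


subsection \<open>Planar domains\<close>

definition plane_P :: "(real^3) set" where
  "plane_P = {p. p$1 = 0}"

definition plane_R :: "(real^3) set" where
  "plane_R = {p. p$3 = 0}"

definition simple_closed_curve :: "'a::topological_space set \<Rightarrow> bool" where
  "simple_closed_curve C \<longleftrightarrow>
     (\<exists>c. simple_path c \<and> pathfinish c = pathstart c \<and> path_image c = C)"

text \<open>The library's \<^const>\<open>inside\<close>, relative to the plane \<open>Q\<close> instead of the whole space.\<close>

definition bounded_domain :: "'a::metric_space set \<Rightarrow> 'a set \<Rightarrow> 'a set" where
  "bounded_domain Q C = {p \<in> Q - C. bounded (connected_component_set (Q - C) p)}"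

definition ext_in :: "'a::topological_space set \<Rightarrow> 'a set \<Rightarrow> 'a set" where
  "ext_in Q D = Q - closure D"

end

theory Submission
  imports Defs
begin

text \<open>Let \<open>K\<close> be the boundary curve of \<open>M\<close>, let \<open>x\<^sub>k\<close> be the coordinate that vanishes on the given plane
(\<open>k = 1\<close> or \<open>k = 3\<close>), and suppose that \<open>M\<close> has points on both sides of the plane. Let \<open>p\<close> be a
highest and \<open>q\<close> a lowest point of \<open>M\<close> with respect to \<open>x\<^sub>k\<close>. Two facts contradict each other.

The first one is geometric. The mean curvature \<open>H\<close> changes its sign together with the unit normal
\<open>N\<close>, so \<open>n = sgn(H) N\<close> does not depend on any choice: since \<open>H\<close> does not vanish, it is a global
continuous unit normal on \<open>M - K\<close>. The planes \<open>x\<^sub>k = const\<close> are minimal surfaces of \<open>Sol\<close>.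
Comparing \<open>M\<close> with such a plane at \<open>p\<close> and at \<open>q\<close> shows that \<open>n\<close> points down at \<open>p\<close> and up at
\<open>q\<close> (\<open>mean_curvature_at_extremum\<close>). Hence \<open>p - t n(p)\<close> lies above all of \<open>M\<close> and \<open>q - t n(q)\<close>
below all of \<open>M\<close>, for every \<open>t > 0\<close>.

The second one is topological. Call a decomposition of \<open>U - M\<close> into two disjoint open sets a
splitting of \<open>U\<close> if both sets accumulate at every point of \<open>M\<close> in \<open>U\<close>. As \<open>M - K\<close> is locally
two-sided, a splitting of a connected set is unique up to exchanging the two sets, and \<open>M\<close> splits
every convex open set that misses \<open>K\<close>, in particular both open half-spaces bounded by the plane
(\<open>splits_convex\<close>). Name the two sets of the upper splitting \<open>A\<close>, \<open>A'\<close> and those of the lower one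
\<open>B\<close>, \<open>B'\<close>, so that everything above \<open>M\<close> is in \<open>A\<close> and everything below \<open>M\<close> is in \<open>B\<close>. At a
point of the plane outside \<open>K\<close>, either \<open>A\<close> continues to \<open>B\<close> and \<open>A'\<close> to \<open>B'\<close>, or \<open>A\<close> continues
to \<open>B'\<close> and \<open>A'\<close> to \<open>B\<close>. By uniqueness this is locally constant, hence constant on the inner domain
\<open>D\<close> and on the outer domain of \<open>K\<close> in the plane (\<open>joined_connected\<close>). On the outer domain \<open>A\<close>
continues to \<open>B\<close>, because far away there are no points of \<open>M\<close>. If this were the case on \<open>D\<close> as
well, then \<open>M\<close> would split the complement of \<open>K\<close>; but near a point of \<open>K\<close> the complement of \<open>M\<close> is
connected (\<open>boundary_essential\<close>). So \<open>A\<close> continues to \<open>B'\<close> across \<open>D\<close>, and \<open>M\<close> splits a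
neighbourhood of the two half-spaces and \<open>D\<close> in such a way that the region above \<open>M\<close> and the region
below \<open>M\<close> are on different sides (\<open>splits_opposite_sides\<close>). Since \<open>M\<close> avoids the outer domain, this
neighbourhood contains \<open>M - K\<close>.

The side of that splitting to which \<open>- n\<close> points is locally constant along \<open>M - K\<close>
(\<open>normal_side_constant\<close>), which is connected. At \<open>p\<close> it is the side above \<open>M\<close>, at \<open>q\<close> the side
below \<open>M\<close>: a contradiction.\<close>

section \<open>Splittings by a two-sided set\<close>

definition splits :: "'a::euclidean_space set \<Rightarrow> 'a set \<Rightarrow> 'a set \<Rightarrow> 'a set \<Rightarrow> bool" where
  "splits M U A B \<longleftrightarrow>
     open U \<and> open A \<and> open B \<and> A \<inter> B = {} \<and> A \<union> B = U - M \<and> U \<inter> M \<subseteq> closure A \<inter> closure B"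

text \<open>The two sides are connected here; this is what makes splittings unique near \<open>x\<close>.\<close>

definition two_sided_at :: "'a::euclidean_space set \<Rightarrow> 'a \<Rightarrow> bool" where
  "two_sided_at M x \<longleftrightarrow>
     (\<forall>W. open W \<and> x \<in> W \<longrightarrow>
        (\<exists>G A B. x \<in> G \<and> G \<subseteq> W \<and> splits M G A B \<and> connected A \<and> connected B))"

lemma splitsI:
  assumes "open U" "open A" "open B" "A \<inter> B = {}" "A \<union> B = U - M"
    and "\<And>x. x \<in> U \<Longrightarrow> x \<in> M \<Longrightarrow> x \<in> closure A \<and> x \<in> closure B"
  shows "splits M U A B"
  using assms unfolding splits_def by auto

lemma splitsD:
  assumes "splits M U A B"
  shows "open U" "open A" "open B" "A \<inter> B = {}" "A \<union> B = U - M" "A \<subseteq> U" "B \<subseteq> U"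
    and "\<And>x. x \<in> U \<Longrightarrow> x \<in> M \<Longrightarrow> x \<in> closure A"
    and "\<And>x. x \<in> U \<Longrightarrow> x \<in> M \<Longrightarrow> x \<in> closure B"
  using assms unfolding splits_def by blast+

lemma splits_swap: "splits M U A B \<Longrightarrow> splits M U B A"
  unfolding splits_def by (simp add: Int_commute Un_commute)

lemma splits_restrict:
  assumes c: "splits M U A B" and V: "open V" "V \<subseteq> U"
  shows "splits M V (A \<inter> V) (B \<inter> V)"
proof (rule splitsI)
  have cl: "V \<inter> closure S \<subseteq> closure (S \<inter> V)" for S
    using open_Int_closure_subset[OF V(1), of S] by (simp add: Int_commute)
  show "x \<in> closure (A \<inter> V) \<and> x \<in> closure (B \<inter> V)" if "x \<in> V" "x \<in> M" for x
    using splitsD(8,9)[OF c, of x] cl[of A] cl[of B] that V by blast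
  show "A \<inter> V \<union> B \<inter> V = V - M" using splitsD(5)[OF c] V(2) by blast
  show "A \<inter> V \<inter> (B \<inter> V) = {}" using splitsD(4)[OF c] by blast
qed (use splitsD(2,3)[OF c] V(1) in auto)

lemma splits_Union:
  assumes c: "\<And>i. i \<in> I \<Longrightarrow> splits M (U i) (A i) (B i)"
    and d: "\<And>i j. \<lbrakk>i \<in> I; j \<in> I\<rbrakk> \<Longrightarrow> A i \<inter> B j = {}"
  shows "splits M (\<Union>i\<in>I. U i) (\<Union>i\<in>I. A i) (\<Union>i\<in>I. B i)"
proof (rule splitsI)
  have "A i \<union> B i = U i - M" if "i \<in> I" for i using splitsD(5)[OF c[OF that]] .
  then show "(\<Union>i\<in>I. A i) \<union> (\<Union>i\<in>I. B i) = (\<Union>i\<in>I. U i) - M" by blast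
  show "(\<Union>i\<in>I. A i) \<inter> (\<Union>i\<in>I. B i) = {}" using d by blast
  show "x \<in> closure (\<Union>i\<in>I. A i) \<and> x \<in> closure (\<Union>i\<in>I. B i)" if x: "x \<in> (\<Union>i\<in>I. U i)" "x \<in> M" for x
  proof -
    obtain i where i: "i \<in> I" "x \<in> U i" using x(1) by blast
    have "closure (A i) \<subseteq> closure (\<Union>i\<in>I. A i)" "closure (B i) \<subseteq> closure (\<Union>i\<in>I. B i)"
      using i by (auto intro!: closure_mono)
    then show ?thesis using splitsD(8,9)[OF c[OF i(1)] i(2) x(2)] by blast
  qed
qed (use splitsD(1-3)[OF c] in auto)

text \<open>Near every point of \<open>U\<close> the two splittings have either the same or exchanged sides. Both
alternatives are open conditions, so one of them holds throughout the connected set \<open>U\<close>.\<close>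

lemma splits_unique:
  assumes c1: "splits M U A B" and c2: "splits M U C D" and U: "connected U"
    and loc: "\<And>x. x \<in> U \<inter> M \<Longrightarrow> two_sided_at M x"
  shows "(C = A \<and> D = B) \<or> (C = B \<and> D = A)"
proof -
  define S where "S = A \<inter> C \<union> B \<inter> D"
  define T where "T = A \<inter> D \<union> B \<inter> C"
  have oU: "open U" and sub: "U \<inter> M \<subseteq> closure A" and ABU: "A \<union> B = U - M" "C \<union> D = U - M"
    and AB: "A \<inter> B = {}" "C \<inter> D = {}" and op: "open A" "open B" "open C" "open D"
    using splitsD[OF c1] splitsD[OF c2] by blast+
  have oST: "open S" "open T" unfolding S_def T_def using op by auto
  have ST: "S \<inter> T = {}" "S \<union> T = U - M"
  proof -
    show "S \<inter> T = {}" unfolding S_def T_def using AB by blast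
    have "S \<union> T = (A \<union> B) \<inter> (C \<union> D)" unfolding S_def T_def by blast
    then show "S \<union> T = U - M" using ABU by simp
  qed
  have dich: "x \<in> interior (S \<union> M) \<or> x \<in> interior (T \<union> M)" if x: "x \<in> U" for x
  proof (cases "x \<in> M")
    case False
    then have "x \<in> S \<or> x \<in> T" using x ST by auto
    then show ?thesis using oST by (meson interiorI sup_ge1)
  next
    case True
    obtain G P Q where G: "x \<in> G" "G \<subseteq> U" "splits M G P Q" "connected P" "connected Q"
      using loc[of x] True x oU unfolding two_sided_at_def by blast
    have PQ: "P \<union> Q = G - M" "P \<inter> Q = {}" "open P" "open Q" "open G"
      using splitsD[OF G(3)] G True by blast+
    \<comment> \<open>Each half of \<open>G\<close> is connected and so lies on one side; the halves cannot be on the same side,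
      since both sides accumulate at \<open>x\<close>.\<close>
    have one: "P \<subseteq> X \<and> Q \<subseteq> Y \<or> P \<subseteq> Y \<and> Q \<subseteq> X" if XY: "splits M U X Y" for X Y
    proof -
      have o: "open X" "open Y" "X \<inter> Y = {}" "X \<union> Y = U - M" "x \<in> closure X" "x \<in> closure Y"
        using splitsD[OF XY] True x by blast+
      have "P \<subseteq> X \<or> P \<subseteq> Y" "Q \<subseteq> X \<or> Q \<subseteq> Y"
      proof -
        have "P \<subseteq> X \<union> Y" "Q \<subseteq> X \<union> Y" "X \<inter> Y \<inter> P = {}" "X \<inter> Y \<inter> Q = {}"
          using o(3,4) PQ(1) G(2) by blast+
        then show "P \<subseteq> X \<or> P \<subseteq> Y" "Q \<subseteq> X \<or> Q \<subseteq> Y"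
          using connectedD[OF G(4) o(1,2)] connectedD[OF G(5) o(1,2)] by blast+
      qed
      moreover have "G \<inter> X \<noteq> {}" "G \<inter> Y \<noteq> {}"
        using o(5,6) G(1) open_Int_closure_eq_empty[OF PQ(5)] by blast+
      moreover have "G \<inter> X \<subseteq> P \<union> Q" "G \<inter> Y \<subseteq> P \<union> Q" using o(4) PQ(1) by blast+
      ultimately show ?thesis using o(3) by blast
    qed
    have "P \<union> Q \<subseteq> S \<or> P \<union> Q \<subseteq> T"
      using one[OF c1] one[OF c2] unfolding S_def T_def by blast
    then have "G \<subseteq> S \<union> M \<or> G \<subseteq> T \<union> M" using PQ by blast
    then show ?thesis using PQ(5) G(1) by (meson interiorI)
  qed
  have "interior (S \<union> M) \<inter> interior (T \<union> M) \<inter> U = {}"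
  proof (rule ccontr)
    assume ne: "interior (S \<union> M) \<inter> interior (T \<union> M) \<inter> U \<noteq> {}"
    let ?I = "interior (S \<union> M) \<inter> interior (T \<union> M) \<inter> U"
    have "?I \<subseteq> M" using ST(1) interior_subset by blast
    with ne obtain x where x: "x \<in> ?I" "x \<in> M" by blast
    moreover have "open ?I" using oU by auto
    ultimately have "?I \<inter> A \<noteq> {}"
      using sub open_Int_closure_eq_empty[of ?I A] by blast
    then show False using \<open>?I \<subseteq> M\<close> ABU by blast
  qed
  then have "U \<subseteq> interior (S \<union> M) \<or> U \<subseteq> interior (T \<union> M)"
    using connectedD[OF U, of "interior (S \<union> M)" "interior (T \<union> M)"] dich by blast
  then have "U \<subseteq> S \<union> M \<or> U \<subseteq> T \<union> M" using interior_subset by blast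
  then show ?thesis
  proof
    assume "U \<subseteq> S \<union> M"
    then show ?thesis unfolding S_def using AB ABU by blast
  next
    assume "U \<subseteq> T \<union> M"
    then show ?thesis unfolding T_def using AB ABU by blast
  qed
qed

section \<open>Existence on convex sets\<close>

lemma splits_unique_at:
  assumes "splits M U A B" "splits M U C D" "connected U"
    and "\<And>x. x \<in> U \<inter> M \<Longrightarrow> two_sided_at M x" and "z \<in> A \<inter> C"
  shows "C = A \<and> D = B"
  using splits_unique[OF assms(1-4)] splitsD(4)[OF assms(2)] assms(5) by blast

text \<open>On the connected overlap the splittings agree up to an exchange, which can be made on \<open>V\<close>.\<close>

lemma splits_glue:
  assumes c1: "splits M U A B" and c2: "splits M V C D" and conn: "connected (U \<inter> V)"
    and loc: "\<And>x. x \<in> U \<inter> V \<inter> M \<Longrightarrow> two_sided_at M x"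
  shows "\<exists>E F. splits M (U \<union> V) E F"
proof -
  have glue: "\<exists>E F. splits M (U \<union> V) E F" if c3: "splits M V E' F'" and eq: "E' \<inter> (U \<inter> V) = A \<inter> (U \<inter> V)" "F' \<inter> (U \<inter> V) = B \<inter> (U \<inter> V)" for E' F'
  proof -
    have "A \<inter> F' = {}" "E' \<inter> B = {}"
      using splitsD(4,6,7)[OF c1] splitsD(4,6,7)[OF c3] eq by blast+
    then have "splits M (\<Union>i\<in>{False,True}. if i then U else V) (\<Union>i\<in>{False,True}. if i then A else E')
                 (\<Union>i\<in>{False,True}. if i then B else F')"
      using c1 c3 splitsD(4)[OF c1] splitsD(4)[OF c3] by (intro splits_Union) auto
    moreover have "(\<Union>i\<in>{False,True}. if i then U else V) = U \<union> V" by auto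
    ultimately show ?thesis by metis
  qed
  have o: "open (U \<inter> V)" using splitsD(1)[OF c1] splitsD(1)[OF c2] by auto
  have "(C \<inter> (U \<inter> V) = A \<inter> (U \<inter> V) \<and> D \<inter> (U \<inter> V) = B \<inter> (U \<inter> V)) \<or>
        (C \<inter> (U \<inter> V) = B \<inter> (U \<inter> V) \<and> D \<inter> (U \<inter> V) = A \<inter> (U \<inter> V))"
    by (rule splits_unique[OF splits_restrict[OF c1 o] splits_restrict[OF c2 o] conn loc]) auto
  then show ?thesis
    using glue[OF c2] glue[OF splits_swap[OF c2]] by metis
qed

lemma splits_ball:
  assumes M: "closed M" and x: "x \<notin> M \<or> two_sided_at M x" and C: "open C" "x \<in> C"
  shows "\<exists>e>0. ball x e \<subseteq> C \<and> (\<exists>A B. splits M (ball x e) A B)"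
proof (cases "x \<in> M")
  case False
  then have "open (C - M)" "x \<in> C - M" using M C by auto
  then obtain e where e: "e > 0" "ball x e \<subseteq> C - M" by (meson open_contains_ball)
  then have "splits M (ball x e) (ball x e) {}" unfolding splits_def by auto
  then show ?thesis using e by blast
next
  case True
  then obtain G A B where G: "x \<in> G" "G \<subseteq> C" "splits M G A B"
    using x C unfolding two_sided_at_def by blast
  then obtain e where e: "e > 0" "ball x e \<subseteq> G" unfolding splits_def by (meson open_contains_ball)
  then show ?thesis using splits_restrict[OF G(3) open_ball e(2)] G by blast
qed

text \<open>Cover the segment by balls of one radius that have splittings, and move along it in short steps. The
neighbourhood already reached and the next ball-sized piece are convex, so that their overlap is
connected and \<open>splits_glue\<close> applies.\<close>

lemma splits_segment:
  assumes M: "closed M" and C: "convex C" "open C" and a: "a \<in> C" and b: "b \<in> C"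
    and loc: "\<And>x. x \<in> C \<inter> M \<Longrightarrow> two_sided_at M x"
  shows "\<exists>V A B. convex V \<and> closed_segment a b \<subseteq> V \<and> V \<subseteq> C \<and> splits M V A B"
proof -
  have sub: "closed_segment a b \<subseteq> C" using C a b by (simp add: closed_segment_subset)
  define \<G> where "\<G> = {W. open W \<and> W \<subseteq> C \<and> (\<exists>A B. splits M W A B)}"
  have "closed_segment a b \<subseteq> \<Union>\<G>"
  proof
    fix x assume "x \<in> closed_segment a b"
    then have "x \<in> C" using sub by auto
    then obtain e where "e > 0" "ball x e \<subseteq> C" "\<exists>A B. splits M (ball x e) A B"
      using splits_ball[OF M _ C(2), of x] loc by blast
    then show "x \<in> \<Union>\<G>" unfolding \<G>_def using centre_in_ball open_ball by blast
  qed
  then obtain e where e: "e > 0" "\<And>x. x \<in> closed_segment a b \<Longrightarrow> \<exists>W\<in>\<G>. ball x e \<subseteq> W"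
    using Heine_Borel_lemma[of "closed_segment a b" \<G>] unfolding \<G>_def by (metis (no_types, lifting) compact_segment mem_Collect_eq)
  have balls: "ball x e \<subseteq> C \<and> (\<exists>A B. splits M (ball x e) A B)" if x: "x \<in> closed_segment a b" for x
  proof -
    obtain W where "W \<in> \<G>" "ball x e \<subseteq> W" using e(2)[OF x] by blast
    then show ?thesis unfolding \<G>_def using splits_restrict[OF _ open_ball] by blast
  qed
  define d where "d = e / 2"
  have d: "d > 0" using e d_def by simp
  obtain n :: nat where n: "n > 0" "norm (b - a) / n < d"
  proof -
    obtain n :: nat where "norm (b - a) / d < n" using reals_Archimedean2 by blast
    moreover have "norm (b - a) / d \<ge> 0" using d by simp
    ultimately have "n > 0" by (metis gr0I not_less of_nat_0)
    moreover have "norm (b - a) / n < d" using \<open>norm (b - a) / d < n\<close> d \<open>n > 0\<close> by (simp add: field_simps)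
    ultimately show ?thesis using that by blast
  qed
  define p where "p i = a + (real i / n) *\<^sub>R (b - a)" for i :: nat
  \<comment> \<open>The tube of radius \<open>d\<close> around a segment, as a sum of convex sets.\<close>
  define T where "T p q = (\<Union>u\<in>closed_segment p q. \<Union>v\<in>ball (0::'a) d. {u + v})" for p q
  have conv: "convex (T p q)" for p q
    unfolding T_def by (intro convex_sums) auto
  have opn: "open (T p q)" for p q
  proof -
    have "T p q = (\<Union>u\<in>closed_segment p q. ball u d)"
    proof -
      have "(\<Union>v\<in>ball (0::'a) d. {u + v}) = ball u d" for u
        using ball_translation[of u 0 d] by (auto simp: image_def)
      then show ?thesis unfolding T_def by simp
    qed
    then show ?thesis by auto
  qed
  have T_mem: "x \<in> T p q \<longleftrightarrow> (\<exists>u\<in>closed_segment p q. dist u x < d)" for x p q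
  proof
    assume "x \<in> T p q" then show "\<exists>u\<in>closed_segment p q. dist u x < d"
      unfolding T_def by (force simp: dist_norm)
  next
    assume "\<exists>u\<in>closed_segment p q. dist u x < d"
    then obtain u where u: "u \<in> closed_segment p q" "dist u x < d" by blast
    have "x = u + (x - u)" "x - u \<in> ball 0 d" using u by (auto simp: dist_norm norm_minus_commute)
    then show "x \<in> T p q" unfolding T_def using u by blast
  qed
  have pin: "p i \<in> closed_segment a b" if "i \<le> n" for i
  proof -
    have "0 \<le> real i / n" "real i / n \<le> 1" using that n by auto
    moreover have "p i = (1 - real i / n) *\<^sub>R a + (real i / n) *\<^sub>R b"
      unfolding p_def by (simp add: algebra_simps)
    ultimately show ?thesis unfolding in_segment by blast
  qed
  have step: "dist (p i) (p (Suc i)) < d" for i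
  proof -
    have "p (Suc i) - p i = (1 / n) *\<^sub>R (b - a)"
      unfolding p_def by (simp add: add_divide_distrib scaleR_add_left)
    then have "norm (p (Suc i) - p i) = norm (b - a) / n" by (simp add: divide_inverse mult.commute)
    then show ?thesis using n by (simp add: dist_norm norm_minus_commute)
  qed
  have small: "T (p i) (p (Suc i)) \<subseteq> ball (p i) e" for i
  proof
    fix x assume "x \<in> T (p i) (p (Suc i))"
    then obtain u where u: "u \<in> closed_segment (p i) (p (Suc i))" "dist u x < d" using T_mem by blast
    have "dist (p i) u < d" using u(1) step[of i] segment_bound(1)[of u "p i" "p (Suc i)"]
      by (simp add: dist_norm norm_minus_commute)
    then show "x \<in> ball (p i) e" using u(2) dist_triangle[of "p i" x u] unfolding d_def by simp
  qed
  have main: "i \<le> n \<Longrightarrow> T a (p i) \<subseteq> C \<and> (\<exists>A B. splits M (T a (p i)) A B)" for i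
  proof (induction i)
    case 0
    have "T a (p 0) \<subseteq> ball (p 0) e"
    proof
      fix x assume "x \<in> T a (p 0)"
      then show "x \<in> ball (p 0) e" using d e(1) unfolding T_mem by (auto simp: p_def d_def)
    qed
    then show ?case using balls[OF pin[of 0]] splits_restrict[OF _ opn] by fastforce
  next
    case (Suc i)
    then have IH: "T a (p i) \<subseteq> C" "\<exists>A B. splits M (T a (p i)) A B" and i: "i \<le> n" by auto
    obtain A B where AB: "splits M (T a (p i)) A B" using IH by blast
    obtain A' B' where AB': "splits M (T (p i) (p (Suc i))) A' B'"
      using balls[OF pin[OF i]] splits_restrict[OF _ opn small] by blast
    have sub': "T (p i) (p (Suc i)) \<subseteq> C" using balls[OF pin[OF i]] small by blast
    have "connected (T a (p i) \<inter> T (p i) (p (Suc i)))"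
      using conv by (intro convex_connected convex_Int)
    then obtain E F where EF: "splits M (T a (p i) \<union> T (p i) (p (Suc i))) E F"
      using splits_glue[OF AB AB'] loc IH(1) by blast
    have "p i \<in> closed_segment a (p (Suc i))"
    proof -
      have "p i = (1 - real i / Suc i) *\<^sub>R a + (real i / Suc i) *\<^sub>R p (Suc i)"
      proof -
        have "(real i / Suc i) * (real (Suc i) / n) = real i / n" by (simp add: divide_simps)
        then show ?thesis unfolding p_def by (simp add: algebra_simps)
      qed
      moreover have "0 \<le> real i / Suc i" "real i / Suc i \<le> 1" by auto
      ultimately show ?thesis unfolding in_segment by blast
    qed
    then have "closed_segment a (p (Suc i)) = closed_segment a (p i) \<union> closed_segment (p i) (p (Suc i))"
      using Un_closed_segment by blast
    then have "T a (p (Suc i)) = T a (p i) \<union> T (p i) (p (Suc i))"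
      unfolding T_def by auto
    then show ?case using EF IH(1) sub' by auto
  qed
  have "p n = b" unfolding p_def using n by simp
  moreover have "closed_segment a b \<subseteq> T a b" using T_mem d by fastforce
  ultimately show ?thesis using main[of n] conv by auto
qed

text \<open>This replaces the vanishing of the first cohomology of \<open>C\<close> with coefficients in \<open>\<int>/2\<close>: splittings
near the segments from a base point \<open>c\<close> are normalised by the side that contains \<open>c\<close>, and then fit
together because two convex neighbourhoods of \<open>c\<close> have a connected intersection.\<close>

lemma splits_convex:
  assumes M: "closed M" and C: "convex C" "open C"
    and loc: "\<And>x. x \<in> C \<inter> M \<Longrightarrow> two_sided_at M x"
  shows "\<exists>A B. splits M C A B"
proof (cases "C - M = {}")
  case True
  have "C = {}"
  proof (rule ccontr)
    assume "C \<noteq> {}"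
    then obtain x where x: "x \<in> C" "x \<in> M" using True by blast
    then obtain G A B where G: "x \<in> G" "G \<subseteq> C" "splits M G A B"
      using loc[of x] C unfolding two_sided_at_def by blast
    then have "A = {}" "x \<in> closure A" using True x unfolding splits_def by blast+
    then show False by simp
  qed
  then show ?thesis unfolding splits_def by auto
next
  case False
  then obtain c where c: "c \<in> C" "c \<notin> M" by blast
  have "\<exists>V A B. convex V \<and> c \<in> V \<and> x \<in> V \<and> V \<subseteq> C \<and> splits M V A B \<and> c \<in> A" if x: "x \<in> C" for x
  proof -
    obtain V A B where V: "convex V" "closed_segment c x \<subseteq> V" "V \<subseteq> C" "splits M V A B"
      using splits_segment[OF M C c(1) x loc] by blast
    have "c \<in> V" "x \<in> V" using V(2) by auto
    moreover from this c have "c \<in> A \<or> c \<in> B" using V(4) unfolding splits_def by blast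
    ultimately show ?thesis using V splits_swap by metis
  qed
  then obtain V A B where V: "\<And>x. x \<in> C \<Longrightarrow> convex (V x) \<and> c \<in> V x \<and> x \<in> V x \<and> V x \<subseteq> C \<and> splits M (V x) (A x) (B x) \<and> c \<in> A x"
    by metis
  have "splits M (\<Union>x\<in>C. V x) (\<Union>x\<in>C. A x) (\<Union>x\<in>C. B x)"
  proof (rule splits_Union)
    fix x y assume xy: "x \<in> C" "y \<in> C"
    have o: "open (V x \<inter> V y)" using V xy unfolding splits_def by blast
    have "A y \<inter> (V x \<inter> V y) = A x \<inter> (V x \<inter> V y) \<and> B y \<inter> (V x \<inter> V y) = B x \<inter> (V x \<inter> V y)"
    proof (rule splits_unique_at)
      show "splits M (V x \<inter> V y) (A x \<inter> (V x \<inter> V y)) (B x \<inter> (V x \<inter> V y))"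
        using V xy o by (intro splits_restrict) auto
      show "splits M (V x \<inter> V y) (A y \<inter> (V x \<inter> V y)) (B y \<inter> (V x \<inter> V y))"
        using V xy o by (intro splits_restrict) auto
      show "connected (V x \<inter> V y)" using V xy by (intro convex_connected convex_Int) auto
      show "two_sided_at M z" if "z \<in> V x \<inter> V y \<inter> M" for z using that V xy loc by blast
      show "c \<in> A x \<inter> (V x \<inter> V y) \<inter> (A y \<inter> (V x \<inter> V y))" using V xy by blast
    qed
    moreover have "A x \<subseteq> V x" "B y \<subseteq> V y" "A x \<inter> B x = {}" using V xy unfolding splits_def by blast+
    ultimately show "A x \<inter> B y = {}" by blast
  qed (use V in blast)
  moreover have "(\<Union>x\<in>C. V x) = C" using V by blast
  ultimately show ?thesis by metis
qed

section \<open>Passing across a hyperplane\<close>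

text \<open>Given splittings \<open>(A, A')\<close> of the open half-space \<open>x\<^sub>k > 0\<close> and \<open>(B, B')\<close> of \<open>x\<^sub>k < 0\<close>, a splitting
\<open>(E, F)\<close> of an open set \<open>U\<close>, which may cross the hyperplane, continues \<open>A\<close> to \<open>B\<close> and \<open>A'\<close> to \<open>B'\<close>.\<close>

definition joins ::
  "(real^'n) set \<Rightarrow> 'n \<Rightarrow> (real^'n) set \<Rightarrow> (real^'n) set \<Rightarrow> (real^'n) set \<Rightarrow> (real^'n) set \<Rightarrow>
   (real^'n) set \<Rightarrow> (real^'n) set \<Rightarrow> (real^'n) set \<Rightarrow> bool" where
  "joins M k A A' B B' U E F \<longleftrightarrow> splits M U E F \<and>
     E \<inter> {x. x$k > 0} \<subseteq> A \<and> F \<inter> {x. x$k > 0} \<subseteq> A' \<and>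
     E \<inter> {x. x$k < 0} \<subseteq> B \<and> F \<inter> {x. x$k < 0} \<subseteq> B'"

definition joined_at ::
  "(real^'n) set \<Rightarrow> 'n \<Rightarrow> (real^'n) set \<Rightarrow> (real^'n) set \<Rightarrow> (real^'n) set \<Rightarrow> (real^'n) set \<Rightarrow>
   real^'n \<Rightarrow> bool" where
  "joined_at M k A A' B B' r \<longleftrightarrow> (\<exists>e>0. \<exists>E F. joins M k A A' B B' (ball r e) E F)"

lemma joins_restrict:
  assumes "joins M k A A' B B' U E F" "open V" "V \<subseteq> U"
  shows "joins M k A A' B B' V (E \<inter> V) (F \<inter> V)"
  using assms splits_restrict[of M U E F V] unfolding joins_def by blast

lemma ball_meets_halfspaces:
  fixes r :: "real^'n"
  assumes "r$k = 0" "e > 0"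
  shows "ball r e \<inter> {x. x$k > 0} \<noteq> {}" "ball r e \<inter> {x. x$k < 0} \<noteq> {}"
proof -
  have "r + (e/2) *\<^sub>R axis k 1 \<in> ball r e" "r - (e/2) *\<^sub>R axis k 1 \<in> ball r e"
    using assms(2) by (auto simp: dist_norm norm_axis_1)
  moreover have "(r + (e/2) *\<^sub>R axis k 1) $ k > 0" "(r - (e/2) *\<^sub>R axis k 1) $ k < 0"
    using assms by auto
  ultimately show "ball r e \<inter> {x. x$k > 0} \<noteq> {}" "ball r e \<inter> {x. x$k < 0} \<noteq> {}" by blast+
qed

lemma open_in_hyperplane_empty:
  fixes W :: "(real^'n) set"
  assumes "open W" "W \<inter> {x. x$k > 0} = {}" "W \<inter> {x. x$k < 0} = {}"
  shows "W = {}"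
proof (rule ccontr)
  assume "W \<noteq> {}"
  then obtain r where r: "r \<in> W" by blast
  then obtain e where e: "e > 0" "ball r e \<subseteq> W" using assms(1) open_contains_ball by blast
  have "r$k = 0" using r assms(2,3) by (cases "r$k" "0::real" rule: linorder_cases) auto
  then show False using ball_meets_halfspaces(1)[OF _ e(1), of r k] e(2) assms(2) by blast
qed

lemma two_sided_not_interior:
  assumes "open W" "W \<noteq> {}" "\<And>x. x \<in> W \<inter> M \<Longrightarrow> two_sided_at M x"
  shows "W - M \<noteq> {}"
proof
  assume "W - M = {}"
  then obtain x where x: "x \<in> W" "x \<in> M" using assms(2) by blast
  then obtain G A B where G: "x \<in> G" "G \<subseteq> W" "splits M G A B"
    using assms(1) assms(3)[of x] unfolding two_sided_at_def by blast
  have "A = {}" using splitsD(5)[OF G(3)] G(2) \<open>W - M = {}\<close> by blast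
  then show False using splitsD(8)[OF G(3)] G x by auto
qed

lemma splits_subset_connected:
  assumes c: "splits M U A B" and S: "connected S" "S \<subseteq> U" "S \<inter> M = {}"
  shows "S \<subseteq> A \<or> S \<subseteq> B"
proof -
  have "S \<subseteq> A \<union> B" using splitsD(5)[OF c] S by blast
  moreover have "A \<inter> B \<inter> S = {}" using splitsD(4)[OF c] by blast
  ultimately show ?thesis using connectedD[OF S(1) splitsD(2,3)[OF c]] by blast
qed

lemma coordinate_halfspaces:
  fixes k :: "'n::finite" and c :: real
  shows "open {x::real^'n. x$k > c}" "open {x::real^'n. x$k < c}"
  "convex {x::real^'n. x$k > c}" "convex {x::real^'n. x$k < c}"
proof -
  show "open {x::real^'n. x$k > c}" "open {x::real^'n. x$k < c}"
    by (intro open_Collect_less continuous_intros)+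
  show "convex {x::real^'n. x$k > c}" "convex {x::real^'n. x$k < c}"
    using convex_halfspace_gt[of c "axis k 1 :: real^'n"] convex_halfspace_lt[of "axis k 1 :: real^'n" c]
    by (simp_all add: inner_axis')
qed

lemma joined_cases:
  fixes M :: "(real^'n) set"
  assumes M: "closed M" and loc: "\<And>x. x \<in> M \<Longrightarrow> x$k \<noteq> 0 \<Longrightarrow> two_sided_at M x"
    and cA: "splits M {x. x$k > 0} A A'" and cB: "splits M {x. x$k < 0} B B'"
    and r: "r \<notin> M \<or> two_sided_at M r"
  shows "joined_at M k A A' B B' r \<or> joined_at M k A A' B' B r"
proof -
  obtain e C D where e: "e > 0" and c: "splits M (ball r e) C D"
    using splits_ball[OF M r open_UNIV] by blast
  have side: "(C \<inter> H \<subseteq> X \<and> D \<inter> H \<subseteq> Y) \<or> (C \<inter> H \<subseteq> Y \<and> D \<inter> H \<subseteq> X)"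
    if cH: "splits M H X Y" and H: "convex H" "\<And>x. x \<in> H \<Longrightarrow> x$k \<noteq> 0" for H X Y
  proof -
    have o: "open (ball r e \<inter> H)" using splitsD(1)[OF cH] by auto
    have "(X \<inter> (ball r e \<inter> H) = C \<inter> (ball r e \<inter> H) \<and> Y \<inter> (ball r e \<inter> H) = D \<inter> (ball r e \<inter> H)) \<or>
          (X \<inter> (ball r e \<inter> H) = D \<inter> (ball r e \<inter> H) \<and> Y \<inter> (ball r e \<inter> H) = C \<inter> (ball r e \<inter> H))"
      using loc H by (intro splits_unique[OF splits_restrict[OF c o] splits_restrict[OF cH o]]
          convex_connected convex_Int) auto
    then show ?thesis using splitsD(6,7)[OF c] by blast
  qed
  have "(C \<inter> {x. x$k > 0} \<subseteq> A \<and> D \<inter> {x. x$k > 0} \<subseteq> A') \<or> (C \<inter> {x. x$k > 0} \<subseteq> A' \<and> D \<inter> {x. x$k > 0} \<subseteq> A)"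
    by (rule side[OF cA coordinate_halfspaces(3)]) auto
  moreover have "(C \<inter> {x. x$k < 0} \<subseteq> B \<and> D \<inter> {x. x$k < 0} \<subseteq> B') \<or> (C \<inter> {x. x$k < 0} \<subseteq> B' \<and> D \<inter> {x. x$k < 0} \<subseteq> B)"
    by (rule side[OF cB coordinate_halfspaces(4)]) auto
  ultimately show ?thesis
    unfolding joined_at_def joins_def using e c splits_swap[OF c] by metis
qed

text \<open>If both held, the two local splittings would agree on one half of a small ball and be exchanged on
the other half, against uniqueness on the ball.\<close>

lemma joined_exclusive:
  fixes M :: "(real^'n) set"
  assumes loc: "\<And>x. x \<in> M \<Longrightarrow> x \<notin> K \<Longrightarrow> two_sided_at M x" and K: "closed K" "r \<notin> K"
    and AB: "A \<inter> A' = {}" "B \<inter> B' = {}" and r: "r$k = 0"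
    and j1: "joined_at M k A A' B B' r" and j2: "joined_at M k A A' B' B r"
  shows False
proof -
  obtain d C D where d: "d > 0" "joins M k A A' B B' (ball r d) C D"
    using j1 unfolding joined_at_def by blast
  obtain e E F where e: "e > 0" "joins M k A A' B' B (ball r e) E F"
    using j2 unfolding joined_at_def by blast
  obtain f where f: "f > 0" "ball r f \<subseteq> - K"
    using K open_contains_ball[of "- K"] by (auto simp: open_Compl)
  define V where "V = ball r (min f (min d e))"
  have pos: "min f (min d e) > 0" using d e f by auto
  have V: "open V" "connected V" "V \<subseteq> ball r d" "V \<subseteq> ball r e" "V \<subseteq> - K"
    using f unfolding V_def by auto
  have locV: "\<And>x. x \<in> V \<inter> M \<Longrightarrow> two_sided_at M x" using loc V(5) by auto
  have J1: "joins M k A A' B B' V (C \<inter> V) (D \<inter> V)" and J2: "joins M k A A' B' B V (E \<inter> V) (F \<inter> V)"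
    using joins_restrict d(2) e(2) V by blast+
  then have c1: "splits M V (C \<inter> V) (D \<inter> V)" and c2: "splits M V (E \<inter> V) (F \<inter> V)"
    unfolding joins_def by auto
  have "open (V \<inter> {x. x$k > 0})" "open (V \<inter> {x. x$k < 0})"
    using V(1) coordinate_halfspaces by (intro open_Int; blast)+
  then obtain z w where z: "z \<in> V" "z$k > 0" "z \<notin> M" and w: "w \<in> V" "w$k < 0" "w \<notin> M"
    using two_sided_not_interior[of "V \<inter> {x. x$k > 0}" M] two_sided_not_interior[of "V \<inter> {x. x$k < 0}" M]
      ball_meets_halfspaces[OF r pos] locV unfolding V_def by blast
  have *: "E \<inter> V = C \<inter> V \<and> F \<inter> V = D \<inter> V \<or> E \<inter> V = D \<inter> V \<and> F \<inter> V = C \<inter> V"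
    by (rule splits_unique[OF c1 c2 V(2) locV])
  have zin: "z \<in> C \<inter> V \<union> D \<inter> V" and win: "w \<in> C \<inter> V \<union> D \<inter> V" using splitsD(5)[OF c1] z w by blast+
  from * show False
  proof
    assume "E \<inter> V = C \<inter> V \<and> F \<inter> V = D \<inter> V"
    then have "w \<in> B \<inter> B'" using J1 J2 win w unfolding joins_def by blast
    then show False using AB by blast
  next
    assume "E \<inter> V = D \<inter> V \<and> F \<inter> V = C \<inter> V"
    then have "z \<in> A \<inter> A'" using J1 J2 zin z unfolding joins_def by blast
    then show False using AB by blast
  qed
qed

lemma joined_open:
  assumes "joined_at M k A A' B B' r"
  shows "\<exists>e>0. \<forall>s\<in>ball r e. joined_at M k A A' B B' s"
proof -
  obtain e E F where e: "e > 0" and j: "joins M k A A' B B' (ball r e) E F"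
    using assms unfolding joined_at_def by blast
  have "joined_at M k A A' B B' s" if s: "s \<in> ball r e" for s
  proof -
    obtain d where "d > 0" "ball s d \<subseteq> ball r e" using s open_contains_ball[of "ball r e"] open_ball by blast
    then show ?thesis unfolding joined_at_def using joins_restrict[OF j open_ball] by blast
  qed
  then show ?thesis using e by blast
qed

lemma joined_connected:
  fixes M :: "(real^'n) set"
  assumes M: "closed M" and loc: "\<And>x. x \<in> M \<Longrightarrow> x \<notin> K \<Longrightarrow> two_sided_at M x" and K: "closed K" "K \<subseteq> {x. x$k = 0}"
    and cA: "splits M {x. x$k > 0} A A'" and cB: "splits M {x. x$k < 0} B B'"
    and S: "connected S" "S \<subseteq> {x. x$k = 0} - K"
  shows "(\<forall>r\<in>S. joined_at M k A A' B B' r) \<or> (\<forall>r\<in>S. joined_at M k A A' B' B r)"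
proof -
  let ?J = "{r. joined_at M k A A' B B' r}" and ?J' = "{r. joined_at M k A A' B' B r}"
  have o: "open ?J" "open ?J'" unfolding open_contains_ball using joined_open by blast+
  have "two_sided_at M x" if "x \<in> M" "x$k \<noteq> 0" for x using loc[OF that(1)] that(2) K(2) by blast
  then have "S \<subseteq> ?J \<union> ?J'"
    using joined_cases[OF M _ cA cB] loc S(2) by blast
  moreover have "?J \<inter> ?J' \<inter> S = {}"
    using joined_exclusive[of M K, OF _ K(1) _ splitsD(4)[OF cA] splitsD(4)[OF cB]] loc S(2) by blast
  ultimately show ?thesis using connectedD[OF S(1) o] by blast
qed

text \<open>All splittings that are compatible with the given ones on the half-spaces are glued at once. If
opposite sides of two of them overlapped, the overlap would be an open subset of the hyperplane.\<close>

lemma splits_across_plane: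
  fixes M :: "(real^'n) set"
  assumes cA: "splits M {x. x$k > 0} A A'" and cB: "splits M {x. x$k < 0} B B'"
    and j: "\<And>r. r \<in> S \<Longrightarrow> joined_at M k A A' B B' r"
  shows "\<exists>U E F. splits M U E F \<and> {x. x$k \<noteq> 0} \<union> S \<subseteq> U \<and> A \<union> B \<subseteq> E \<and> A' \<union> B' \<subseteq> F"
proof -
  define I where "I = {(U, E, F). joins M k A A' B B' U E F}"
  have AA: "A \<inter> A' = {}" "B \<inter> B' = {}" using splitsD(4)[OF cA] splitsD(4)[OF cB] .
  have "splits M (\<Union>i\<in>I. fst i) (\<Union>i\<in>I. fst (snd i)) (\<Union>i\<in>I. snd (snd i))"
  proof (rule splits_Union)
    show "splits M (fst i) (fst (snd i)) (snd (snd i))" if "i \<in> I" for i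
      using that unfolding I_def joins_def by auto
    fix i l assume "i \<in> I" "l \<in> I"
    then obtain U E F V G H where J: "joins M k A A' B B' U E F" "joins M k A A' B B' V G H"
      and il: "i = (U, E, F)" "l = (V, G, H)" unfolding I_def by auto
    have "E \<inter> H = {}"
    proof (rule open_in_hyperplane_empty)
      show "open (E \<inter> H)" using J splitsD(2,3) unfolding joins_def by blast
      show "E \<inter> H \<inter> {x. x$k > 0} = {}" "E \<inter> H \<inter> {x. x$k < 0} = {}"
        using J AA unfolding joins_def by blast+
    qed
    then show "fst (snd i) \<inter> snd (snd l) = {}" using il by simp
  qed
  moreover have i1: "({x. x$k > 0}, A, A') \<in> I" "({x. x$k < 0}, B, B') \<in> I"
    unfolding I_def joins_def using cA cB splitsD(6,7)[OF cA] splitsD(6,7)[OF cB] by force+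
  then have "{x. x$k > 0} \<subseteq> (\<Union>i\<in>I. fst i)" "{x. x$k < 0} \<subseteq> (\<Union>i\<in>I. fst i)"
    "A \<union> B \<subseteq> (\<Union>i\<in>I. fst (snd i))" "A' \<union> B' \<subseteq> (\<Union>i\<in>I. snd (snd i))" by force+
  moreover have "S \<subseteq> (\<Union>i\<in>I. fst i)"
  proof
    fix r assume "r \<in> S"
    then obtain e E F where "e > 0" "joins M k A A' B B' (ball r e) E F"
      using j unfolding joined_at_def by blast
    then have "(ball r e, E, F) \<in> I" "r \<in> ball r e" unfolding I_def by auto
    then show "r \<in> (\<Union>i\<in>I. fst i)" by force
  qed
  moreover have "{x::real^'n. x$k \<noteq> 0} = {x. x$k > 0} \<union> {x. x$k < 0}" by auto
  ultimately show ?thesis by (metis Un_least)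
qed

text \<open>The topological heart of the proof. \<open>K\<close> stands for the boundary curve, \<open>S\<close> and \<open>T\<close> for the inner and
the outer domain in the hyperplane, and the point \<open>r\<close> of \<open>T\<close> is beyond all of \<open>M\<close> in another
coordinate. Joining \<open>A\<close> to \<open>B\<close> across both domains would give a splitting of the complement of \<open>K\<close>;
as they are joined across \<open>T\<close>, they are not joined across \<open>S\<close>.\<close>

lemma splits_opposite_sides:
  fixes M :: "(real^'n) set"
  assumes M: "closed M" and K: "closed K" "K \<subseteq> {x. x$k = 0}"
    and loc: "\<And>x. x \<in> M \<Longrightarrow> x \<notin> K \<Longrightarrow> two_sided_at M x"
    and ST: "connected S" "connected T" "S \<union> T = {x. x$k = 0} - K" and disj: "M \<inter> T = {}"
    and essential: "\<And>U A B. - K \<subseteq> U \<Longrightarrow> \<not> splits M U A B"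
    and far: "r \<in> T" "j \<noteq> k" "r$j > c" "\<And>x. x \<in> M \<Longrightarrow> x$j \<le> c"
    and top: "0 \<le> a" "\<And>x. x \<in> M \<Longrightarrow> x$k \<le> a"
    and bot: "b \<le> 0" "\<And>x. x \<in> M \<Longrightarrow> b \<le> x$k"
  shows "\<exists>U A B. splits M U A B \<and> M - K \<subseteq> U \<and> {x. x$k > a} \<subseteq> A \<and> {x. x$k < b} \<subseteq> B"
proof -
  have loc': "two_sided_at M x" if "x \<in> M" "x$k \<noteq> 0" for x using loc[OF that(1)] that(2) K(2) by blast
  obtain A A' where cA: "splits M {x. x$k > 0} A A'" and topA: "{x. x$k > a} \<subseteq> A"
  proof -
    obtain A A' where c: "splits M {x. x$k > 0} A A'"
      using splits_convex[OF M coordinate_halfspaces(3,1)[where c=0 and k=k]] loc' by fastforce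
    have "{x. x$k > a} \<subseteq> A \<or> {x. x$k > a} \<subseteq> A'"
      using top coordinate_halfspaces(3) by (intro splits_subset_connected[OF c] convex_connected) force+
    then show ?thesis using that c splits_swap by blast
  qed
  obtain B B' where cB: "splits M {x. x$k < 0} B B'" and botB: "{x. x$k < b} \<subseteq> B"
  proof -
    obtain B B' where c: "splits M {x. x$k < 0} B B'"
      using splits_convex[OF M coordinate_halfspaces(4,2)[where c=0 and k=k]] loc' by fastforce
    have "{x. x$k < b} \<subseteq> B \<or> {x. x$k < b} \<subseteq> B'"
      using bot coordinate_halfspaces(4) by (intro splits_subset_connected[OF c] convex_connected) force+
    then show ?thesis using that c splits_swap by blast
  qed
  \<comment> \<open>The half-space \<open>x\<^sub>j > c\<close> misses \<open>M\<close> and meets both \<open>A\<close> and \<open>B\<close>, so that \<open>A\<close> continues to \<open>B\<close> inside it.\<close>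
  let ?H = "{x. x$j > c}"
  have HM: "?H \<inter> M = {}" using far(4) by force
  have pt: "\<exists>x::real^'n. x$j > c \<and> x$k = t" for t
    using far(2) by (intro exI[of _ "\<chi> i. if i = k then t else c + 1"]) auto
  have HA: "?H \<inter> {x. x$k > 0} \<subseteq> A"
  proof -
    have "?H \<inter> {x. x$k > 0} \<subseteq> A \<or> ?H \<inter> {x. x$k > 0} \<subseteq> A'"
      using HM coordinate_halfspaces(3) by (intro splits_subset_connected[OF cA] convex_connected convex_Int) auto
    moreover have "?H \<inter> {x. x$k > 0} \<inter> A \<noteq> {}"
      using pt[of "a + 1"] topA top(1) by fastforce
    ultimately show ?thesis using splitsD(4)[OF cA] by blast
  qed
  have HB: "?H \<inter> {x. x$k < 0} \<subseteq> B"
  proof -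
    have "?H \<inter> {x. x$k < 0} \<subseteq> B \<or> ?H \<inter> {x. x$k < 0} \<subseteq> B'"
      using HM coordinate_halfspaces(3,4) by (intro splits_subset_connected[OF cB] convex_connected convex_Int) auto
    moreover have "?H \<inter> {x. x$k < 0} \<inter> B \<noteq> {}"
      using pt[of "b - 1"] botB bot(1) by fastforce
    ultimately show ?thesis using splitsD(4)[OF cB] by blast
  qed
  have rj: "joined_at M k A A' B B' r"
  proof -
    obtain e where e: "e > 0" "ball r e \<subseteq> ?H"
      using coordinate_halfspaces(1)[of c j] far(3) open_contains_ball by (metis mem_Collect_eq)
    have "splits M (ball r e) (ball r e) {}" using e HM by (intro splitsI) auto
    then have "joins M k A A' B B' (ball r e) (ball r e) {}" unfolding joins_def using HA HB e by blast
    then show ?thesis unfolding joined_at_def using e by blast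
  qed
  have conn: "(\<forall>r\<in>Z. joined_at M k A A' B B' r) \<or> (\<forall>r\<in>Z. joined_at M k A A' B' B r)"
    if "connected Z" "Z \<subseteq> {x. x$k = 0} - K" for Z
    using joined_connected[OF M _ K cA cB that] loc by blast
  have rK: "r$k = 0" "r \<notin> K" using ST(3) far(1) by blast+
  have "\<not> joined_at M k A A' B' B r"
    using joined_exclusive[OF _ K(1) rK(2) splitsD(4)[OF cA] splitsD(4)[OF cB] rK(1) rj] loc by blast
  then have T: "\<forall>s\<in>T. joined_at M k A A' B B' s"
    using conn[OF ST(2)] ST(3) far(1) by blast
  have S: "\<forall>s\<in>S. joined_at M k A A' B' B s"
  proof (rule ccontr)
    assume "\<not> ?thesis"
    then have "\<forall>s\<in>S. joined_at M k A A' B B' s" using conn[OF ST(1)] ST(3) by auto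
    then obtain U E F where "splits M U E F" "{x. x$k \<noteq> 0} \<union> (S \<union> T) \<subseteq> U"
      using splits_across_plane[OF cA cB, of "S \<union> T"] T by blast
    then show False using essential[of U E F] ST(3) by blast
  qed
  then obtain U E F where "splits M U E F" "{x. x$k \<noteq> 0} \<union> S \<subseteq> U" "A \<union> B' \<subseteq> E" "A' \<union> B \<subseteq> F"
    using splits_across_plane[OF cA splits_swap[OF cB], of S] by blast
  moreover from this have "M - K \<subseteq> U" using ST(3) disj by blast
  ultimately show ?thesis using topA botB by blast
qed

section \<open>Slice charts\<close>

lemma Ck_on_subset: "Ck_on k U f \<Longrightarrow> V \<subseteq> U \<Longrightarrow> Ck_on k V f"
proof (induction k arbitrary: f)
  case 0
  then show ?case by (auto intro: continuous_on_subset)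
next
  case (Suc k)
  then show ?case by simp blast
qed

lemma smooth_on_subset: "smooth_on U f \<Longrightarrow> V \<subseteq> U \<Longrightarrow> smooth_on V f"
  unfolding smooth_on_def using Ck_on_subset by blast

lemma smooth_on_continuous_on: "smooth_on U f \<Longrightarrow> continuous_on U f"
  unfolding smooth_on_def by (metis Ck_on.simps(1))

lemma smooth_on_has_derivative:
  assumes "smooth_on U f" "x \<in> U"
  shows "(f has_derivative frechet_derivative f (at x)) (at x)"
proof -
  have "Ck_on (Suc 0) U f" using assms(1) unfolding smooth_on_def by blast
  then show ?thesis using assms(2) frechet_derivative_works by auto
qed

lemma smooth_on_directional_deriv:
  assumes "smooth_on U f"
  shows "smooth_on U (\<lambda>x. frechet_derivative f (at x) v)"
  unfolding smooth_on_def
proof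
  fix k
  have "Ck_on (Suc k) U f" using assms unfolding smooth_on_def by blast
  then show "Ck_on k U (\<lambda>x. frechet_derivative f (at x) v)" by simp
qed

lemma slice_chartD:
  assumes "slice_chart M S U V \<phi> \<psi>"
  shows "open U" "open V" "smooth_on U \<phi>" "smooth_on V \<psi>" "continuous_on U \<phi>" "continuous_on V \<psi>"
    "\<And>x. x \<in> U \<Longrightarrow> \<phi> x \<in> V" "\<And>x. x \<in> U \<Longrightarrow> \<psi> (\<phi> x) = x"
    "\<And>y. y \<in> V \<Longrightarrow> \<psi> y \<in> U" "\<And>y. y \<in> V \<Longrightarrow> \<phi> (\<psi> y) = y"
    "\<And>x. x \<in> U \<Longrightarrow> x \<in> M \<longleftrightarrow> \<phi> x \<in> S"
proof -
  have h: "homeomorphism U V \<phi> \<psi>" and img: "\<phi> ` (M \<inter> U) = V \<inter> S"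
    and "open U" "open V" "smooth_on U \<phi>" "smooth_on V \<psi>"
    using assms unfolding slice_chart_def by blast+
  then show "open U" "open V" "smooth_on U \<phi>" "smooth_on V \<psi>" by blast+
  show "continuous_on U \<phi>" "continuous_on V \<psi>"
    using h unfolding homeomorphism_def by blast+
  show VU: "\<And>x. x \<in> U \<Longrightarrow> \<phi> x \<in> V" "\<And>x. x \<in> U \<Longrightarrow> \<psi> (\<phi> x) = x"
    "\<And>y. y \<in> V \<Longrightarrow> \<psi> y \<in> U" "\<And>y. y \<in> V \<Longrightarrow> \<phi> (\<psi> y) = y"
    using h unfolding homeomorphism_def by blast+
  show "x \<in> M \<longleftrightarrow> \<phi> x \<in> S" if x: "x \<in> U" for x
  proof
    show "x \<in> M \<Longrightarrow> \<phi> x \<in> S" using img x by blast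
    assume "\<phi> x \<in> S"
    then have "\<phi> x \<in> \<phi> ` (M \<inter> U)" using img VU(1)[OF x] by blast
    then obtain y where "y \<in> M" "y \<in> U" "\<phi> x = \<phi> y" by blast
    then show "x \<in> M" using VU(2)[OF x] VU(2)[of y] by metis
  qed
qed

lemma slice_chart_image:
  assumes c: "slice_chart M S U V \<phi> \<psi>" and W: "open W" "W \<subseteq> U"
  shows "open (\<phi> ` W)" "\<phi> ` W \<subseteq> V"
proof -
  show "\<phi> ` W \<subseteq> V" using slice_chartD(7)[OF c] W by blast
  have "\<phi> ` W = V \<inter> \<psi> -` W"
  proof (intro set_eqI iffI)
    fix y assume "y \<in> \<phi> ` W" then show "y \<in> V \<inter> \<psi> -` W" using slice_chartD(7,8)[OF c] W(2) by force
  next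
    fix y assume "y \<in> V \<inter> \<psi> -` W" then show "y \<in> \<phi> ` W" using slice_chartD(10)[OF c] by (metis IntD1 IntD2 imageI vimageD)
  qed
  then show "open (\<phi> ` W)"
    using continuous_open_preimage[OF slice_chartD(6,2)[OF c] W(1)] by simp
qed

lemma slice_chart_preimage:
  assumes c: "slice_chart M S U V \<phi> \<psi>" and W: "open W" "W \<subseteq> V"
  shows "open (\<psi> ` W)" "\<psi> ` W \<subseteq> U" "\<psi> ` W = {x \<in> U. \<phi> x \<in> W}"
proof -
  show "\<psi> ` W \<subseteq> U" using slice_chartD(9)[OF c] W by blast
  show eq: "\<psi> ` W = {x \<in> U. \<phi> x \<in> W}"
  proof (intro set_eqI iffI)
    fix y assume "y \<in> \<psi> ` W" then show "y \<in> {x \<in> U. \<phi> x \<in> W}" using slice_chartD(9,10)[OF c] W(2) by force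
  next
    fix y assume "y \<in> {x \<in> U. \<phi> x \<in> W}" then show "y \<in> \<psi> ` W" using slice_chartD(8)[OF c] by force
  qed
  have "{x \<in> U. \<phi> x \<in> W} = U \<inter> \<phi> -` W" by blast
  then show "open (\<psi> ` W)"
    using continuous_open_preimage[OF slice_chartD(5,1)[OF c] W(1)] eq by simp
qed

lemma slice_chart_neighbourhood:
  assumes c: "slice_chart M S U V \<phi> \<psi>" and W: "open W" "x \<in> W" "x \<in> U"
  obtains r where "r > 0" "ball (\<phi> x) r \<subseteq> V" "\<psi> ` ball (\<phi> x) r \<subseteq> W"
proof -
  have o: "open (U \<inter> W)" using slice_chartD(1)[OF c] W by blast
  have "open (\<phi> ` (U \<inter> W))" "\<phi> x \<in> \<phi> ` (U \<inter> W)"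
    using slice_chart_image(1)[OF c o] W by auto
  then obtain r where r: "r > 0" "ball (\<phi> x) r \<subseteq> \<phi> ` (U \<inter> W)" by (meson open_contains_ball)
  have "ball (\<phi> x) r \<subseteq> V" using r(2) slice_chartD(7)[OF c] by blast
  moreover have "\<psi> y \<in> W" if y: "y \<in> ball (\<phi> x) r" for y
  proof -
    obtain z where "z \<in> U \<inter> W" "y = \<phi> z" using r(2) y by blast
    then show ?thesis using slice_chartD(8)[OF c, of z] by simp
  qed
  ultimately show ?thesis using that[OF r(1)] by blast
qed

text \<open>The model may change, too: away from its edge the half plane is a piece of the flat model.\<close>

lemma slice_chart_restrict:
  assumes c: "slice_chart M S U V \<phi> \<psi>" and W: "open W" "W \<subseteq> U"
    and S': "\<And>x. x \<in> W \<Longrightarrow> \<phi> x \<in> S \<longleftrightarrow> \<phi> x \<in> S'"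
  shows "slice_chart M S' W (\<phi> ` W) \<phi> \<psi>"
  unfolding slice_chart_def
proof (intro conjI)
  note im = slice_chart_image[OF c W]
  show "open W" "open (\<phi> ` W)" using W im by auto
  have "homeomorphism U V \<phi> \<psi>" using c unfolding slice_chart_def by blast
  then show "homeomorphism W (\<phi> ` W) \<phi> \<psi>"
    using W im by (metis homeomorphism_of_subsets order_refl homeomorphism_cong)
  show "smooth_on W \<phi>" "smooth_on (\<phi> ` W) \<psi>"
    using slice_chartD(3,4)[OF c] W im smooth_on_subset by blast+
  show "\<phi> ` (M \<inter> W) = \<phi> ` W \<inter> S'"
  proof -
    have "y \<in> \<phi> ` (M \<inter> W) \<longleftrightarrow> y \<in> \<phi> ` W \<inter> S'" for y
    proof (cases "y \<in> \<phi> ` W")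
      case True
      then obtain x where x: "x \<in> W" "y = \<phi> x" by blast
      have "x \<in> M \<longleftrightarrow> y \<in> S'" using slice_chartD(11)[OF c, of x] S'[OF x(1)] W(2) x by auto
      moreover have "y \<in> \<phi> ` (M \<inter> W) \<Longrightarrow> x \<in> M"
      proof -
        assume "y \<in> \<phi> ` (M \<inter> W)"
        then obtain z where z: "z \<in> M" "z \<in> W" "y = \<phi> z" by blast
        have "x \<in> U" "z \<in> U" using x(1) z(2) W(2) by blast+
        then have "z = x" using slice_chartD(8)[OF c, of x] slice_chartD(8)[OF c, of z] x(2) z(3) by simp
        then show "x \<in> M" using z by simp
      qed
      ultimately show ?thesis using x True by blast
    qed auto
    then show ?thesis by blast
  qed
qed

lemma half_chart_interior:
  assumes c: "slice_chart M half_model U V \<phi> \<psi>" and x: "x \<in> M" "x \<in> U" "\<phi> x $ 2 > 0"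
  shows "x \<in> surface_interior M"
proof -
  let ?W = "U \<inter> \<phi> -` {y. y$2 > 0}"
  have "open ?W"
    by (intro continuous_open_preimage slice_chartD(1,5)[OF c] coordinate_halfspaces)
  then have "slice_chart M flat_model ?W (\<phi> ` ?W) \<phi> \<psi>"
    by (intro slice_chart_restrict[OF c]) (auto simp: half_model_def flat_model_def)
  then have "\<exists>U V \<phi> \<psi>. x \<in> U \<and> slice_chart M flat_model U V \<phi> \<psi>"
    using x(2,3) by (intro exI[of _ ?W] exI[of _ "\<phi> ` ?W"] exI[of _ \<phi>] exI[of _ \<psi>]) simp
  then show ?thesis unfolding surface_interior_def using x(1) by simp
qed

lemma flat_chart_splits:
  assumes c: "slice_chart M flat_model U V \<phi> \<psi>" and W: "open W" "x \<in> W" "x \<in> U" "x \<in> M"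
  obtains G where "x \<in> G" "G \<subseteq> W" "G \<subseteq> U"
    "splits M G {z \<in> G. \<phi> z $ 3 > 0} {z \<in> G. \<phi> z $ 3 < 0}"
    "connected {z \<in> G. \<phi> z $ 3 > 0}" "connected {z \<in> G. \<phi> z $ 3 < 0}"
proof -
  obtain r where r: "r > 0" "ball (\<phi> x) r \<subseteq> V" "\<psi> ` ball (\<phi> x) r \<subseteq> W"
    using slice_chart_neighbourhood[OF c W(1-3)] by blast
  define G where "G = \<psi> ` ball (\<phi> x) r"
  note pre = slice_chart_preimage[OF c open_ball r(2), folded G_def]
  have xG: "x \<in> G" using pre(3) W(3) r(1) by simp
  have part: "{z \<in> G. \<phi> z \<in> H} = \<psi> ` (ball (\<phi> x) r \<inter> H)" for H
    using slice_chartD(8,10)[OF c] r(2) unfolding G_def pre(3) by force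
  have halves: "open {z \<in> G. \<phi> z \<in> H} \<and> connected {z \<in> G. \<phi> z \<in> H}" if "open H" "convex H" for H
  proof -
    have "open (ball (\<phi> x) r \<inter> H)" "connected (ball (\<phi> x) r \<inter> H)"
      using that by (auto intro: convex_connected convex_Int)
    then show ?thesis unfolding part
      using slice_chart_preimage(1)[OF c, of "ball (\<phi> x) r \<inter> H"] r(2)
        connected_continuous_image[OF continuous_on_subset[OF slice_chartD(6)[OF c]], of "ball (\<phi> x) r \<inter> H"]
      by blast
  qed
  have meets: "y \<in> closure {z \<in> G. \<phi> z \<in> H}" if y: "y \<in> G" and H: "\<And>e. e > 0 \<Longrightarrow> ball (\<phi> y) e \<inter> H \<noteq> {}" for y H
  proof (rule ccontr)
    assume n: "y \<notin> closure {z \<in> G. \<phi> z \<in> H}"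
    let ?W = "G - closure {z \<in> G. \<phi> z \<in> H}"
    have "open ?W" using pre(1) by blast
    then have "open (\<phi> ` ?W)" "\<phi> y \<in> \<phi> ` ?W"
      using slice_chart_image(1)[OF c] pre(2) n y by blast+
    then obtain e where "e > 0" "ball (\<phi> y) e \<subseteq> \<phi> ` ?W" by (meson open_contains_ball)
    then show False using H[of e] closure_subset[of "{z \<in> G. \<phi> z \<in> H}"] by blast
  qed
  note pos = halves[OF coordinate_halfspaces(1,3)[where k=3 and c=0], simplified]
    and neg = halves[OF coordinate_halfspaces(2,4)[where k=3 and c=0], simplified]
  have "splits M G {z \<in> G. \<phi> z $ 3 > 0} {z \<in> G. \<phi> z $ 3 < 0}"
  proof (rule splitsI)
    show "open G" by (rule pre)
    show "open {z \<in> G. \<phi> z $ 3 > 0}" "open {z \<in> G. \<phi> z $ 3 < 0}" using pos neg by auto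
    show "{z \<in> G. \<phi> z $ 3 > 0} \<inter> {z \<in> G. \<phi> z $ 3 < 0} = {}" by auto
    have "z \<in> M \<longleftrightarrow> \<phi> z $ 3 = 0" if "z \<in> G" for z
      using slice_chartD(11)[OF c, of z] that pre(2) by (auto simp: flat_model_def)
    then show "{z \<in> G. \<phi> z $ 3 > 0} \<union> {z \<in> G. \<phi> z $ 3 < 0} = G - M" by force
    fix y assume y: "y \<in> G" "y \<in> M"
    then have "\<phi> y $ 3 = 0" using slice_chartD(11)[OF c, of y] pre(2) by (auto simp: flat_model_def)
    then show "y \<in> closure {z \<in> G. 0 < \<phi> z $ 3} \<and> y \<in> closure {z \<in> G. \<phi> z $ 3 < 0}"
      using meets[OF y(1), of "{x. x$3 > 0}", OF ball_meets_halfspaces(1)]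
        meets[OF y(1), of "{x. x$3 < 0}", OF ball_meets_halfspaces(2)] by simp
  qed
  then show ?thesis using that[of G] xG pre(2) r(3) pos neg unfolding G_def by blast
qed

lemma interior_two_sided: "x \<in> surface_interior M \<Longrightarrow> two_sided_at M x"
  unfolding two_sided_at_def
proof (intro allI impI)
  fix W assume x: "x \<in> surface_interior M" and W: "open W \<and> x \<in> W"
  then obtain U V \<phi> \<psi> where c: "slice_chart M flat_model U V \<phi> \<psi>" "x \<in> U" "x \<in> M"
    unfolding surface_interior_def by blast
  show "\<exists>G A B. x \<in> G \<and> G \<subseteq> W \<and> splits M G A B \<and> connected A \<and> connected B"
  proof -
    obtain G where G: "x \<in> G" "G \<subseteq> W" "splits M G {z \<in> G. \<phi> z $ 3 > 0} {z \<in> G. \<phi> z $ 3 < 0}"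
      "connected {z \<in> G. \<phi> z $ 3 > 0}" "connected {z \<in> G. \<phi> z $ 3 < 0}"
      by (rule flat_chart_splits[OF c(1) conjunct1[OF W] conjunct2[OF W] c(2,3)]) (rule that)
    then show ?thesis by (intro exI conjI)
  qed
qed

text \<open>A ball minus a half plane with edge through its centre is star-shaped with respect to a point
opposite to the half plane.\<close>

lemma half_chart_complement:
  assumes c: "slice_chart M half_model U V \<phi> \<psi>" and x: "x \<in> U" "\<phi> x $ 2 = 0" "\<phi> x $ 3 = 0"
    and r: "r > 0" "ball (\<phi> x) r \<subseteq> V"
  shows "connected (\<psi> ` ball (\<phi> x) r - M)"
proof -
  let ?b = "ball (\<phi> x) r" and ?s = "\<phi> x - (r/2) *\<^sub>R axis 2 1"
  have mem: "y \<in> half_model \<longleftrightarrow> y$3 = 0 \<and> y$2 \<ge> 0" for y by (simp add: half_model_def)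
  have s3: "?s $ 3 = 0" "?s $ 2 = - r/2" using x by (simp_all add: axis_def)
  have "?s \<in> ?b" using r(1) by (simp add: dist_norm norm_axis_1)
  moreover have "?s \<notin> half_model" using r(1) s3(2) unfolding mem by linarith
  ultimately have s: "?s \<in> ?b - half_model" by blast
  have "closed_segment ?s y \<subseteq> ?b - half_model" if y: "y \<in> ?b - half_model" for y
  proof
    fix z assume z: "z \<in> closed_segment ?s y"
    have zb: "z \<in> ?b" using z s y convex_ball[of "\<phi> x" r] by (meson DiffD1 closed_segment_subset subsetD)
    obtain u where u: "0 \<le> u" "u \<le> 1" "z = (1 - u) *\<^sub>R ?s + u *\<^sub>R y"
      using z unfolding in_segment by blast
    have z3: "z$3 = u * y$3" "z$2 = (1 - u) * (- r/2) + u * y$2"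
      unfolding u(3) vector_add_component vector_scaleR_component s3 by auto
    have "z \<notin> half_model"
    proof
      assume "z \<in> half_model"
      then have *: "u * y$3 = 0" "(1 - u) * (- r/2) + u * y$2 \<ge> 0" unfolding mem z3 by auto
      show False
      proof (cases "u = 0")
        case True then show False using * r(1) by simp
      next
        case False
        have "y \<notin> half_model" using y by blast
        then have "y$2 < 0" using *(1) False unfolding mem by simp
        then have "u * y$2 < 0" using u False by (simp add: mult_pos_neg)
        moreover have "(1 - u) * (- r/2) \<le> 0" using u r(1) by (simp add: mult_nonneg_nonpos)
        ultimately show False using * by linarith
      qed
    qed
    then show "z \<in> ?b - half_model" using zb by blast
  qed
  then have "starlike (?b - half_model)" unfolding starlike_def using s by blast
  then have "connected (\<psi> ` (?b - half_model))"
    using r(2) by (intro connected_continuous_image continuous_on_subset[OF slice_chartD(6)[OF c]] starlike_imp_connected) auto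
  moreover have "\<psi> ` (?b - half_model) = \<psi> ` ?b - M"
    using slice_chartD(9,10,11)[OF c] r(2) by (force simp: subset_iff)
  ultimately show ?thesis by simp
qed

lemma boundary_neighbourhood:
  assumes x: "x \<in> surface_boundary M" and W: "open W" "x \<in> W"
  obtains U V \<phi> \<psi> r where "slice_chart M half_model U V \<phi> \<psi>" "x \<in> U" "\<phi> x $ 2 = 0" "\<phi> x $ 3 = 0"
    "r > 0" "ball (\<phi> x) r \<subseteq> V" "\<psi> ` ball (\<phi> x) r \<subseteq> W"
    "x \<in> \<psi> ` ball (\<phi> x) r" "open (\<psi> ` ball (\<phi> x) r)"
proof -
  obtain U V \<phi> \<psi> where c: "slice_chart M half_model U V \<phi> \<psi>" "x \<in> U" "\<phi> x $ 2 = 0" "x \<in> M"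
    using x unfolding surface_boundary_def by blast
  then obtain r where r: "r > 0" "ball (\<phi> x) r \<subseteq> V" "\<psi> ` ball (\<phi> x) r \<subseteq> W"
    using slice_chart_neighbourhood[OF c(1) W c(2)] by blast
  have "\<phi> x $ 3 = 0" using slice_chartD(11)[OF c(1,2)] c(4) by (simp add: half_model_def)
  moreover have "x \<in> \<psi> ` ball (\<phi> x) r" "open (\<psi> ` ball (\<phi> x) r)"
    using slice_chart_preimage[OF c(1) open_ball r(2)] c(2) r(1) by auto
  ultimately show ?thesis using that c r by blast
qed

text \<open>A small neighbourhood of a boundary point minus \<open>M\<close> is connected, so it cannot meet both sides.\<close>

lemma splits_avoids_surface_boundary:
  assumes spl: "splits M U A B" and x: "x \<in> surface_boundary M"
  shows "x \<notin> U"
proof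
  assume xU: "x \<in> U"
  have xM: "x \<in> M" using x unfolding surface_boundary_def by blast
  from boundary_neighbourhood[OF x splitsD(1)[OF spl] xU] obtain U' V \<phi> \<psi> r
    where c: "slice_chart M half_model U' V \<phi> \<psi>" "x \<in> U'" "\<phi> x $ 2 = 0" "\<phi> x $ 3 = 0"
    "r > 0" "ball (\<phi> x) r \<subseteq> V" and G: "\<psi> ` ball (\<phi> x) r \<subseteq> U"
    "x \<in> \<psi> ` ball (\<phi> x) r" "open (\<psi> ` ball (\<phi> x) r)" by metis
  let ?G = "\<psi> ` ball (\<phi> x) r"
  have "?G - M \<subseteq> A \<or> ?G - M \<subseteq> B"
    using splits_subset_connected[OF spl half_chart_complement[OF c]] G by blast
  moreover have "?G \<inter> A \<noteq> {}" "?G \<inter> B \<noteq> {}"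
    using open_Int_closure_eq_empty[OF G(3)] splitsD(8,9)[OF spl xU xM] G(2) by blast+
  ultimately show False using splitsD(4,5)[OF spl] by blast
qed

text \<open>An invariance of the boundary without invariance of domain: interior points have splittings nearby,
boundary points have none.\<close>

lemma interior_boundary_disjoint:
  assumes "x \<in> surface_interior M" shows "x \<notin> surface_boundary M"
proof -
  obtain G A B where G: "x \<in> G" "splits M G A B"
    using interior_two_sided[OF assms] open_UNIV unfolding two_sided_at_def by (meson UNIV_I)
  then show ?thesis using splits_avoids_surface_boundary by metis
qed

lemma half_chart_interior_part:
  assumes c: "slice_chart M half_model U V \<phi> \<psi>" and x: "x \<in> U" "\<phi> x $ 2 = 0" "\<phi> x $ 3 = 0"
    and r: "r > 0" "ball (\<phi> x) r \<subseteq> V"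
  shows "connected (\<psi> ` ball (\<phi> x) r \<inter> M - surface_boundary M)"
    "\<psi> ` ball (\<phi> x) r \<inter> M - surface_boundary M \<noteq> {}"
proof -
  let ?b = "ball (\<phi> x) r" and ?H = "{y::real^3. y$3 = 0} \<inter> {y. y$2 > 0}"
  have "\<psi> y \<in> M - surface_boundary M \<longleftrightarrow> y \<in> ?H" if y: "y \<in> ?b" for y
  proof -
    have yV: "y \<in> V" using y r(2) by blast
    note P = slice_chartD(9,10)[OF c yV]
    have M: "\<psi> y \<in> M \<longleftrightarrow> y$3 = 0 \<and> y$2 \<ge> 0"
      using slice_chartD(11)[OF c P(1)] P(2) by (simp add: half_model_def)
    have "\<psi> y \<notin> surface_boundary M" if "y$3 = 0" "y$2 > 0"
      using half_chart_interior[OF c _ P(1)] M P(2) that interior_boundary_disjoint by simp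
    moreover have "\<psi> y \<in> surface_boundary M" if "y$3 = 0" "y$2 = 0"
    proof -
      have "\<psi> y \<in> M" "\<psi> y \<in> U" "\<phi> (\<psi> y) $ 2 = 0" using M that P by auto
      then show ?thesis unfolding surface_boundary_def using c by blast
    qed
    ultimately show ?thesis using M by fastforce
  qed
  then have eq: "\<psi> ` ?b \<inter> M - surface_boundary M = \<psi> ` (?b \<inter> ?H)" by blast
  have "convex {y::real^3. y$3 = 0}" by (auto simp: convex_def)
  then have "connected (?b \<inter> ?H)"
    using coordinate_halfspaces(3) by (intro convex_connected convex_Int convex_ball)
  then show "connected (\<psi> ` ?b \<inter> M - surface_boundary M)"
    unfolding eq using r(2)
    by (intro connected_continuous_image continuous_on_subset[OF slice_chartD(6)[OF c]]) auto
  have "\<phi> x + (r/2) *\<^sub>R axis 2 1 \<in> ?b \<inter> ?H"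
  proof -
    have "\<phi> x + (r/2) *\<^sub>R axis 2 1 \<in> ?b" using r(1) by (simp add: dist_norm norm_axis_1)
    then show ?thesis using x r(1) by (simp add: axis_def)
  qed
  then show "\<psi> ` ?b \<inter> M - surface_boundary M \<noteq> {}" unfolding eq by blast
qed

text \<open>In a half chart around a boundary point the complement of \<open>M\<close> is connected, but interior points of
\<open>M\<close> in the same chart force both sides of a splitting to appear there.\<close>

lemma boundary_essential:
  assumes ne: "surface_boundary M \<noteq> {}" and U: "- surface_boundary M \<subseteq> U"
  shows "\<not> splits M U A B"
proof
  assume spl: "splits M U A B"
  obtain x where x: "x \<in> surface_boundary M" using ne by blast
  from boundary_neighbourhood[OF x open_UNIV UNIV_I] obtain U' V \<phi> \<psi> r
    where c: "slice_chart M half_model U' V \<phi> \<psi>" "x \<in> U'" "\<phi> x $ 2 = 0" "\<phi> x $ 3 = 0"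
    "r > 0" "ball (\<phi> x) r \<subseteq> V" and G: "open (\<psi> ` ball (\<phi> x) r)" by metis
  let ?G = "\<psi> ` ball (\<phi> x) r"
  have "surface_boundary M \<subseteq> M" unfolding surface_boundary_def by blast
  then have "?G - M \<subseteq> U" using U by blast
  then have "?G - M \<subseteq> A \<or> ?G - M \<subseteq> B"
    using splits_subset_connected[OF spl half_chart_complement[OF c]] by blast
  moreover obtain y where y: "y \<in> ?G" "y \<in> M" "y \<in> U" using half_chart_interior_part(2)[OF c] U by blast
  then have "?G \<inter> A \<noteq> {}" "?G \<inter> B \<noteq> {}"
    using open_Int_closure_eq_empty[OF G] splitsD(8,9)[OF spl y(3,2)] by blast+
  ultimately show False using splitsD(4,5)[OF spl] by blast
qed

text \<open>A separation of \<open>M - K\<close> extends to \<open>M\<close>, since \<open>M - K\<close> is connected near each point of \<open>K\<close>.\<close>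

lemma connected_minus_surface_boundary:
  assumes M: "connected M"
  shows "connected (M - surface_boundary M)"
proof (rule connectedI)
  let ?K = "surface_boundary M"
  fix S T assume ST: "open S" "open T" "S \<inter> (M - ?K) \<noteq> {}" "T \<inter> (M - ?K) \<noteq> {}"
    "S \<inter> T \<inter> (M - ?K) = {}" "M - ?K \<subseteq> S \<union> T"
  define S' where "S' = \<Union>{G. open G \<and> G \<inter> M - ?K \<subseteq> S}"
  define T' where "T' = \<Union>{G. open G \<and> G \<inter> M - ?K \<subseteq> T}"
  have sub: "S' \<inter> M - ?K \<subseteq> S" "T' \<inter> M - ?K \<subseteq> T" unfolding S'_def T'_def by blast+
  have o: "open S'" "open T'" unfolding S'_def T'_def by auto
  have "S \<subseteq> S'" "T \<subseteq> T'" unfolding S'_def T'_def using ST(1,2) by blast+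
  have near: "\<exists>G. open G \<and> x \<in> G \<and> G \<subseteq> W \<and> connected (G \<inter> M - ?K) \<and> G \<inter> M - ?K \<noteq> {}"
    if x: "x \<in> ?K" "open W" "x \<in> W" for x W
    using boundary_neighbourhood[OF x] half_chart_interior_part by metis
  have cover: "M \<subseteq> S' \<union> T'"
  proof
    fix x assume x: "x \<in> M"
    show "x \<in> S' \<union> T'"
    proof (cases "x \<in> ?K")
      case False then show ?thesis using x ST(6) \<open>S \<subseteq> S'\<close> \<open>T \<subseteq> T'\<close> by blast
    next
      case True
      then obtain G where G: "open G" "x \<in> G" "connected (G \<inter> M - ?K)"
        using near[of x UNIV] by blast
      have "G \<inter> M - ?K \<subseteq> S \<union> T" "S \<inter> T \<inter> (G \<inter> M - ?K) = {}" using ST(5,6) by blast+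
      then have "G \<inter> M - ?K \<subseteq> S \<or> G \<inter> M - ?K \<subseteq> T" using connectedD[OF G(3) ST(1,2)] by blast
      then show ?thesis unfolding S'_def T'_def using G by blast
    qed
  qed
  have "S' \<inter> T' \<inter> M = {}"
  proof (rule ccontr)
    assume "S' \<inter> T' \<inter> M \<noteq> {}"
    then obtain x where x: "x \<in> S'" "x \<in> T'" "x \<in> M" by blast
    show False
    proof (cases "x \<in> ?K")
      case False then show False using x sub ST(5) by blast
    next
      case True
      then obtain G where "G \<subseteq> S' \<inter> T'" "G \<inter> M - ?K \<noteq> {}"
        using near[of x "S' \<inter> T'"] x o by blast
      then show False using sub ST(5) by blast
    qed
  qed
  then show False
    using connectedD[OF M o _ cover] ST(3,4) \<open>S \<subseteq> S'\<close> \<open>T \<subseteq> T'\<close> by blast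
qed

section \<open>Mean curvature in coordinates\<close>

text \<open>The diagonal entries of the metric in the coordinate frame.\<close>

definition sol_weight :: "real^3 \<Rightarrow> 3 \<Rightarrow> real" where
  "sol_weight p i = (if i = 1 then exp (2 * p$3) else if i = 2 then exp (- 2 * p$3) else 1)"

lemma sol_weight_simps [simp]:
  "sol_weight p 1 = exp (2 * p$3)" "sol_weight p 2 = exp (- 2 * p$3)" "sol_weight p 3 = 1"
  by (simp_all add: sol_weight_def)

lemma sol_gram_eq: "sol_gram p = (\<chi> i j. if i = j then sol_weight p i else 0)"
  by (simp add: sol_gram_def vec_eq_iff forall_3 sol_metric_def axis_def)

lemma matrix_inv_sol_gram: "matrix_inv (sol_gram p) = (\<chi> i j. if i = j then 1 / sol_weight p i else 0)"
proof -
  let ?A = "sol_gram p" and ?B = "(\<chi> i j. if i = j then 1 / sol_weight p i else 0) :: real^3^3"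
  have AB: "?A ** ?B = mat 1" "?B ** ?A = mat 1"
    by (simp_all add: sol_gram_eq matrix_matrix_mult_def mat_def vec_eq_iff forall_3 sum_3)
  then have "\<exists>B. ?A ** B = mat 1 \<and> B ** ?A = mat 1" by blast
  then have inv: "matrix_inv ?A ** ?A = mat 1" unfolding matrix_inv_def by (rule someI2_ex) simp
  have "matrix_inv ?A = matrix_inv ?A ** (?A ** ?B)" unfolding AB(1) by simp
  also have "\<dots> = ?B" unfolding matrix_mul_assoc inv by simp
  finally show ?thesis .
qed

lemma sol_gram_deriv_eq:
  "sol_gram_deriv p l i j =
     (if i = j \<and> l = 3 then (if i = 1 then 2 * exp (2 * p$3) else if i = 2 then - 2 * exp (- 2 * p$3) else 0) else 0)"
proof -
  have c: "((\<lambda>q::real^3. q$3) has_derivative (\<lambda>v. v$3)) (at p)"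
    by (rule bounded_linear_imp_has_derivative[OF bounded_linear_vec_nth])
  have d: "((\<lambda>q. sol_gram q $ i $ j) has_derivative
      (\<lambda>v. if i = j then (if i = 1 then 2 * exp (2 * p$3) * v$3 else if i = 2 then - 2 * exp (- 2 * p$3) * v$3 else 0) else 0)) (at p)"
    unfolding sol_gram_eq using exhaust_3[of i] 
    by (cases "i = j"; elim disjE) (auto intro!: derivative_eq_intros c)
  then show ?thesis
    unfolding sol_gram_deriv_def frechet_derivative_at[OF d, symmetric]
    using exhaust_3[of l] by (auto simp: axis_def)
qed

lemma sol_covariant_deriv_eq:
  "sol_covariant_deriv X p v = frechet_derivative X (at p) v +
     vector [v$3 * X p$1 + v$1 * X p$3, - (v$3 * X p$2 + v$2 * X p$3),
             exp (- 2 * p$3) * v$2 * X p$2 - exp (2 * p$3) * v$1 * X p$1]"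
  unfolding sol_covariant_deriv_def
  by (simp add: vec_eq_iff forall_3 sum_3 sol_christoffel_def matrix_inv_sol_gram sol_gram_deriv_eq algebra_simps)

definition tangential :: "(real^3 \<Rightarrow> real^3) \<Rightarrow> real^3 \<Rightarrow> real^3 \<Rightarrow> real^3" where
  "tangential N p v = v - sol_metric p v (N p) *\<^sub>R N p"

lemma sol_mean_curvature_eq:
  "sol_mean_curvature N p = - (\<Sum>i\<in>UNIV. sol_covariant_deriv N p (tangential N p (axis i 1)) $ i) / 2"
  by (simp add: sol_mean_curvature_def trace_def matrix_def tangential_def sol_shape_operator_def sum_negf)

text \<open>Only the derivatives in tangential directions enter, and these are determined by the values of the
normal field on the surface.\<close>

lemma sol_mean_curvature_sign_change:
  assumes N: "N' p = s *\<^sub>R N p" and s: "s * s = 1"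
    and d: "\<And>v. frechet_derivative N' (at p) (tangential N p v) = s *\<^sub>R frechet_derivative N (at p) (tangential N p v)"
  shows "sol_mean_curvature N' p = s * sol_mean_curvature N p"
proof -
  have "sol_metric p v (s *\<^sub>R N p) *\<^sub>R (s *\<^sub>R N p) = (s * s) *\<^sub>R (sol_metric p v (N p) *\<^sub>R N p)" for v
    by (simp add: sol_metric_def algebra_simps)
  then have T: "tangential N' p v = tangential N p v" for v
    unfolding tangential_def N using s by simp
  have "sol_covariant_deriv N' p (tangential N p v) = s *\<^sub>R sol_covariant_deriv N p (tangential N p v)" for v
    unfolding sol_covariant_deriv_eq d N by (simp add: vec_eq_iff forall_3 algebra_simps)
  then show ?thesis unfolding sol_mean_curvature_eq T by (simp add: sum_distrib_left)
qed

lemma continuous_on_sol_mean_curvature: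
  assumes N: "smooth_on W N"
  shows "continuous_on W (sol_mean_curvature N)"
proof -
  have cN: "continuous_on W N" using N by (rule smooth_on_continuous_on)
  have cD: "continuous_on W (\<lambda>p. frechet_derivative N (at p) v)" for v
    using smooth_on_continuous_on[OF smooth_on_directional_deriv[OF N]] .
  have lin: "frechet_derivative N (at p) v = (\<Sum>j\<in>UNIV. v$j *\<^sub>R frechet_derivative N (at p) (axis j 1))" if "p \<in> W" for p v
  proof -
    have l: "linear (frechet_derivative N (at p))"
      using smooth_on_has_derivative[OF N that] has_derivative_linear by blast
    have "v = (\<Sum>j\<in>UNIV. v$j *\<^sub>R axis j 1)" using basis_expansion[of v] by (simp add: scalar_mult_eq_scaleR)
    then have "frechet_derivative N (at p) v = frechet_derivative N (at p) (\<Sum>j\<in>UNIV. v$j *\<^sub>R axis j 1)" by simp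
    then show ?thesis by (simp add: linear_sum[OF l] linear_scale[OF l])
  qed
  have cT: "continuous_on W (\<lambda>p. tangential N p v)" for v
    unfolding tangential_def sol_metric_def by (intro continuous_intros cN)
  define H where "H p = - ((\<Sum>i\<in>UNIV. \<Sum>j\<in>UNIV. tangential N p (axis i 1) $ j * frechet_derivative N (at p) (axis j 1) $ i)
      + (tangential N p (axis 1 1) $ 3 * N p $ 1 + tangential N p (axis 1 1) $ 1 * N p $ 3)
      - (tangential N p (axis 2 1) $ 3 * N p $ 2 + tangential N p (axis 2 1) $ 2 * N p $ 3)
      + (exp (- 2 * p$3) * tangential N p (axis 3 1) $ 2 * N p $ 2
          - exp (2 * p$3) * tangential N p (axis 3 1) $ 1 * N p $ 1)) / 2" for p
  have "continuous_on W H"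
    unfolding H_def by (intro continuous_intros cN cT cD) simp
  moreover have "H p = sol_mean_curvature N p" if "p \<in> W" for p
  proof -
    have "frechet_derivative N (at p) (tangential N p v) $ i =
        (\<Sum>j\<in>UNIV. tangential N p v $ j * frechet_derivative N (at p) (axis j 1) $ i)" for v i
      by (subst lin[OF that]) (simp add: sum_component)
    then show ?thesis
      unfolding H_def sol_mean_curvature_eq sol_covariant_deriv_eq by (simp add: sum_3)
  qed
  ultimately show ?thesis by (rule continuous_on_eq)
qed

section \<open>Unit normals and curves on a surface\<close>

lemma slice_chart_derivs:
  assumes c: "slice_chart M S U V \<phi> \<psi>"
  shows "x \<in> U \<Longrightarrow> frechet_derivative \<psi> (at (\<phi> x)) (frechet_derivative \<phi> (at x) v) = v"
    and "y \<in> V \<Longrightarrow> frechet_derivative \<phi> (at (\<psi> y)) (frechet_derivative \<psi> (at y) w) = w"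
proof -
  have chain: "frechet_derivative g (at (f x)) (frechet_derivative f (at x) v) = v"
    if f: "smooth_on X f" and g: "smooth_on Y g" and X: "open X" "x \<in> X" and fx: "f x \<in> Y"
      and inv: "\<And>z. z \<in> X \<Longrightarrow> g (f z) = z" for f g :: "real^3 \<Rightarrow> real^3" and X Y x v
  proof -
    have "((g \<circ> f) has_derivative (frechet_derivative g (at (f x)) \<circ> frechet_derivative f (at x))) (at x)"
      by (rule diff_chain_at[OF smooth_on_has_derivative[OF f X(2)] smooth_on_has_derivative[OF g fx]])
    moreover have "((g \<circ> f) has_derivative (\<lambda>v. v)) (at x)"
      by (rule has_derivative_transform_within_open[OF has_derivative_ident X]) (simp add: inv)
    ultimately have "frechet_derivative g (at (f x)) \<circ> frechet_derivative f (at x) = (\<lambda>v. v)"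
      by (rule has_derivative_unique)
    then show ?thesis by (metis comp_apply)
  qed
  note D = slice_chartD[OF c]
  show "frechet_derivative \<psi> (at (\<phi> x)) (frechet_derivative \<phi> (at x) v) = v" if "x \<in> U"
    using chain[OF D(3,4,1) that D(7)[OF that]] D(8) by blast
  show "frechet_derivative \<phi> (at (\<psi> y)) (frechet_derivative \<psi> (at y) w) = w" if "y \<in> V"
    using chain[OF D(4,3,2) that D(9)[OF that]] D(10) by blast
qed

lemma slice_chart_tangent:
  assumes "slice_chart M flat_model U V \<phi> \<psi>" "x \<in> U" "frechet_derivative \<phi> (at x) v $ 3 = 0"
  shows "v \<in> surface_tangent M x"
  using assms unfolding surface_tangent_def by blast

lemma smooth_on_along_curve:
  assumes F: "smooth_on X F" "\<gamma> t \<in> X" and \<gamma>: "(\<gamma> has_vector_derivative w) (at t)"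
  shows "((\<lambda>t. F (\<gamma> t)) has_vector_derivative frechet_derivative F (at (\<gamma> t)) w) (at t)"
  using vector_derivative_diff_chain_within[OF \<gamma> has_derivative_at_withinI[OF smooth_on_has_derivative[OF F]]]
  by (simp add: o_def)

text \<open>The image of a straight line in the chart. Its velocity is tangent at all times, not only at \<open>0\<close>, and
is differentiable at \<open>0\<close>, as needed for second derivatives.\<close>

lemma surface_curve:
  assumes c: "slice_chart M flat_model U V \<phi> \<psi>" and x: "x \<in> U" "x \<in> M"
    and v: "frechet_derivative \<phi> (at x) v $ 3 = 0"
  obtains \<delta> \<gamma> \<gamma>' a where "\<delta> > 0" "\<gamma> 0 = x" "\<gamma>' 0 = v"
    "\<And>t. \<bar>t\<bar> < \<delta> \<Longrightarrow> \<gamma> t \<in> M" "\<And>t. \<bar>t\<bar> < \<delta> \<Longrightarrow> \<gamma>' t \<in> surface_tangent M (\<gamma> t)"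
    "\<And>t. \<bar>t\<bar> < \<delta> \<Longrightarrow> (\<gamma> has_vector_derivative \<gamma>' t) (at t)"
    "(\<gamma>' has_vector_derivative a) (at 0)"
proof -
  note D = slice_chartD[OF c]
  define w where "w = frechet_derivative \<phi> (at x) v"
  define l where "l t = \<phi> x + t *\<^sub>R w" for t :: real
  obtain r where r: "r > 0" "ball (\<phi> x) r \<subseteq> V" using D(2,7) x(1) open_contains_ball by blast
  define \<delta> where "\<delta> = r / (norm w + 1)"
  have \<delta>: "\<delta> > 0" unfolding \<delta>_def using r(1) by (simp add: add_nonneg_pos)
  have lV: "l t \<in> V" if "\<bar>t\<bar> < \<delta>" for t
  proof -
    have "\<bar>t\<bar> * norm w \<le> \<bar>t\<bar> * (norm w + 1)" by (simp add: mult_left_mono)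
    also have "\<dots> < r" using that unfolding \<delta>_def by (simp add: pos_less_divide_eq add_nonneg_pos)
    finally show ?thesis using r(2) unfolding l_def by (auto simp: dist_norm)
  qed
  have l3: "l t $ 3 = 0" for t
    using v D(11)[OF x(1)] x(2) unfolding l_def w_def by (simp add: flat_model_def)
  have lder: "(l has_vector_derivative w) (at t)" for t
    unfolding l_def by (auto intro!: derivative_eq_intros)
  show ?thesis
  proof (rule that[of \<delta> "\<lambda>t. \<psi> (l t)" "\<lambda>t. frechet_derivative \<psi> (at (l t)) w"
        "frechet_derivative (\<lambda>y. frechet_derivative \<psi> (at y) w) (at (l 0)) w"])
    have "l 0 = \<phi> x" unfolding l_def by simp
    then show "\<psi> (l 0) = x" "frechet_derivative \<psi> (at (l 0)) w = v"
      using D(8) x(1) slice_chart_derivs(1)[OF c x(1)] unfolding w_def by auto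
    have chain: "((\<lambda>t. f (l t)) has_vector_derivative frechet_derivative f (at (l t)) w) (at t)"
      if "smooth_on V f" "\<bar>t\<bar> < \<delta>" for f :: "real^3 \<Rightarrow> real^3" and t
      by (rule smooth_on_along_curve[OF that(1) lV[OF that(2)] lder])
    show "((\<lambda>t. frechet_derivative \<psi> (at (l t)) w) has_vector_derivative
        frechet_derivative (\<lambda>y. frechet_derivative \<psi> (at y) w) (at (l 0)) w) (at 0)"
      using chain[OF smooth_on_directional_deriv[OF D(4)], of 0] \<delta> by simp
    fix t :: real assume t: "\<bar>t\<bar> < \<delta>"
    show "\<psi> (l t) \<in> M" using D(9,10,11) lV[OF t] l3[of t] by (simp add: flat_model_def)
    show "((\<lambda>t. \<psi> (l t)) has_vector_derivative frechet_derivative \<psi> (at (l t)) w) (at t)"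
      by (rule chain[OF D(4) t])
    have "frechet_derivative \<phi> (at (\<psi> (l t))) (frechet_derivative \<psi> (at (l t)) w) $ 3 = 0"
      using slice_chart_derivs(2)[OF c lV[OF t]] v unfolding w_def by simp
    then show "frechet_derivative \<psi> (at (l t)) w \<in> surface_tangent M (\<psi> (l t))"
      using slice_chart_tangent[OF c D(9)[OF lV[OF t]]] by blast
  qed (rule \<delta>)
qed

lemma unit_normalD:
  assumes "sol_unit_normal_on M W N"
  shows "open W" "smooth_on W N" "continuous_on W N"
    "\<And>q. q \<in> M \<Longrightarrow> q \<in> W \<Longrightarrow> sol_metric q (N q) (N q) = 1"
    "\<And>q v. q \<in> M \<Longrightarrow> q \<in> W \<Longrightarrow> v \<in> surface_tangent M q \<Longrightarrow> sol_metric q (N q) v = 0"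
  using assms smooth_on_continuous_on unfolding sol_unit_normal_on_def by blast+

text \<open>The differential of the third chart coordinate. For a flat chart its kernel is the tangent plane, so
its sign tells to which side of the surface a vector points.\<close>

definition height :: "(real^3 \<Rightarrow> real^3) \<Rightarrow> real^3 \<Rightarrow> real^3 \<Rightarrow> real" where
  "height \<phi> x v = frechet_derivative \<phi> (at x) v $ 3"

lemma linear_height:
  assumes "slice_chart M S U V \<phi> \<psi>" "x \<in> U"
  shows "linear (height \<phi> x)"
proof -
  have "linear (frechet_derivative \<phi> (at x))"
    using smooth_on_has_derivative[OF slice_chartD(3)[OF assms(1)] assms(2)] has_derivative_linear by blast
  then show ?thesis unfolding height_def by (auto simp: linear_iff)
qed

context
  fixes M U V W N \<phi> \<psi> x
  assumes c: "slice_chart M flat_model U V \<phi> \<psi>" and N: "sol_unit_normal_on M W N"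
    and x: "x \<in> M" "x \<in> U" "x \<in> W"
begin

lemma height_normal_nonzero: "height \<phi> x (N x) \<noteq> 0"
proof
  assume "height \<phi> x (N x) = 0"
  then have "N x \<in> surface_tangent M x"
    using slice_chart_tangent[OF c x(2)] unfolding height_def by blast
  then have "sol_metric x (N x) (N x) = 0" using unit_normalD(5)[OF N x(1,3)] by blast
  then show False using unit_normalD(4)[OF N x(1,3)] by simp
qed

lemma height_normal_split: "height \<phi> x (v - (height \<phi> x v / height \<phi> x (N x)) *\<^sub>R N x) = 0"
  using linear_height[OF c x(2)] height_normal_nonzero by (simp add: linear_diff linear_scale)

text \<open>Both sides are linear in \<open>v\<close>, vanish on the tangent plane and equal \<open>1\<close> at the normal.\<close>

lemma metric_normal: "sol_metric x (N x) v = height \<phi> x v / height \<phi> x (N x)"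
proof -
  have "sol_metric x (N x) (v - (height \<phi> x v / height \<phi> x (N x)) *\<^sub>R N x) = 0"
    using unit_normalD(5)[OF N x(1,3)] slice_chart_tangent[OF c x(2)] height_normal_split
    unfolding height_def by blast
  then have "sol_metric x (N x) v = height \<phi> x v / height \<phi> x (N x) * sol_metric x (N x) (N x)"
    unfolding sol_metric_def by (simp add: algebra_simps)
  then show ?thesis using unit_normalD(4)[OF N x(1,3)] by simp
qed

lemma height_tangential: "height \<phi> x (tangential N x v) = 0"
  using height_normal_split[of v] unfolding tangential_def
  by (simp add: metric_normal[symmetric]) (simp add: sol_metric_def mult_ac)

end

lemma sol_metric_ext:
  assumes "\<And>v. sol_metric x a v = sol_metric x b v" shows "a = b"
  using assms[of "axis 1 1"] assms[of "axis 2 1"] assms[of "axis 3 1"]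
  by (simp add: sol_metric_def vec_eq_iff forall_3 axis_def)

lemma sol_metric_commute: "sol_metric x a b = sol_metric x b a"
  by (simp add: sol_metric_def)

lemma unit_normal_unique:
  assumes c: "slice_chart M flat_model U V \<phi> \<psi>" and N: "sol_unit_normal_on M W N" "sol_unit_normal_on M W' N'"
    and x: "x \<in> M" "x \<in> U" "x \<in> W" "x \<in> W'"
  shows "N' x = sgn (height \<phi> x (N x) * height \<phi> x (N' x)) *\<^sub>R N x"
proof -
  let ?a = "height \<phi> x (N x)" and ?b = "height \<phi> x (N' x)"
  note m = metric_normal[OF c N(1) x(1-3)] metric_normal[OF c N(2) x(1,2,4)]
  have nz: "?a \<noteq> 0" "?b \<noteq> 0"
    using height_normal_nonzero[OF c N(1) x(1-3)] height_normal_nonzero[OF c N(2) x(1,2,4)] .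
  have "?b / ?a = ?a / ?b" using m(1)[of "N' x"] m(2)[of "N x"] sol_metric_commute by metis
  then have "?b * ?b = ?a * ?a" using nz by (simp add: field_simps)
  then have "?b = ?a \<or> ?b = - ?a" using square_eq_iff by blast
  then have s: "?a / ?b = sgn (?a * ?b)" using nz by (auto simp: sgn_mult sgn_if)
  have "sol_metric x (N' x) v = sol_metric x ((?a / ?b) *\<^sub>R N x) v" for v
  proof -
    have "sol_metric x ((?a / ?b) *\<^sub>R N x) v = ?a / ?b * sol_metric x (N x) v"
      by (simp add: sol_metric_def algebra_simps)
    then show ?thesis unfolding m using nz by simp
  qed
  then show ?thesis using sol_metric_ext s by metis
qed

lemma continuous_on_height_normal:
  assumes c: "slice_chart M S U V \<phi> \<psi>" and N: "sol_unit_normal_on M W N"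
  shows "continuous_on (U \<inter> W) (\<lambda>x. height \<phi> x (N x))"
proof -
  have "height \<phi> x (N x) = (\<Sum>j\<in>UNIV. N x $ j * frechet_derivative \<phi> (at x) (axis j 1) $ 3)" if "x \<in> U \<inter> W" for x
  proof -
    have l: "linear (height \<phi> x)" using linear_height[OF c] that by blast
    have "N x = (\<Sum>j\<in>UNIV. N x $ j *\<^sub>R axis j 1)" using basis_expansion[of "N x"] by (simp add: scalar_mult_eq_scaleR)
    then have "height \<phi> x (N x) = height \<phi> x (\<Sum>j\<in>UNIV. N x $ j *\<^sub>R axis j 1)" by simp
    then show ?thesis by (simp add: linear_sum[OF l] linear_scale[OF l]) (simp add: height_def)
  qed
  moreover have "continuous_on (U \<inter> W) (\<lambda>x. \<Sum>j\<in>UNIV. N x $ j * frechet_derivative \<phi> (at x) (axis j 1) $ 3)"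
  proof -
    have "continuous_on (U \<inter> W) N" using unit_normalD(3)[OF N] continuous_on_subset by blast
    moreover have "continuous_on (U \<inter> W) (\<lambda>x. frechet_derivative \<phi> (at x) v)" for v
      using smooth_on_continuous_on[OF smooth_on_directional_deriv[OF slice_chartD(3)[OF c]]] continuous_on_subset by blast
    ultimately show ?thesis by (intro continuous_intros)
  qed
  ultimately show ?thesis by (metis (no_types, lifting) continuous_on_cong)
qed

text \<open>Two unit normal fields agree up to a sign at each point of the surface, and by continuity the sign
\<open>s\<close> is constant near \<open>x\<close>. So the tangential derivatives, and with them the mean curvatures, differ by
the same factor \<open>s\<close>, which cancels in the product.\<close>

lemma mean_curvature_normal_unique:
  assumes x: "x \<in> surface_interior M" "x \<in> W" "x \<in> W'"
    and N: "sol_unit_normal_on M W N" "sol_unit_normal_on M W' N'"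
  shows "sgn (sol_mean_curvature N' x) *\<^sub>R N' x = sgn (sol_mean_curvature N x) *\<^sub>R N x"
proof -
  obtain U V \<phi> \<psi> where c: "slice_chart M flat_model U V \<phi> \<psi>" and xU: "x \<in> U" "x \<in> M"
    using x(1) unfolding surface_interior_def by blast
  let ?h = "\<lambda>y. height \<phi> y (N y) * height \<phi> y (N' y)"
  define s where "s = sgn (?h x)"
  have hx: "?h x \<noteq> 0"
    using height_normal_nonzero[OF c N(1) xU(2,1) x(2)] height_normal_nonzero[OF c N(2) xU(2,1) x(3)] by simp
  then have ss: "s * s = 1" unfolding s_def by (auto simp: sgn_if)
  define G where "G = U \<inter> W \<inter> W'"
  have oG: "open G" "x \<in> G" unfolding G_def
    using slice_chartD(1)[OF c] unit_normalD(1)[OF N(1)] unit_normalD(1)[OF N(2)] xU x by auto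
  have "continuous_on (U \<inter> W \<inter> W') (\<lambda>y. height \<phi> y (N y))" "continuous_on (U \<inter> W \<inter> W') (\<lambda>y. height \<phi> y (N' y))"
    by (rule continuous_on_subset[OF continuous_on_height_normal[OF c N(1)]]
        continuous_on_subset[OF continuous_on_height_normal[OF c N(2)]]; blast)+
  then have "continuous_on (U \<inter> W \<inter> W') ?h" by (rule continuous_on_mult)
  then have "continuous_on G (\<lambda>y. s * ?h y)" unfolding G_def by (rule continuous_on_mult_left)
  then have "open (G \<inter> (\<lambda>y. s * ?h y) -` {0<..})"
    using continuous_open_preimage[OF _ oG(1) open_greaterThan] by blast
  moreover have "s * ?h x > 0"
    using hx abs_sgn[of "?h x"] unfolding s_def by (metis mult.commute zero_less_abs_iff)
  ultimately obtain e where e: "e > 0" "ball x e \<subseteq> G \<inter> (\<lambda>y. s * ?h y) -` {0<..}"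
    using oG(2) by (metis (no_types, lifting) IntI greaterThan_iff open_contains_ball vimage_eq)
  have near: "N' y = s *\<^sub>R N y" if y: "y \<in> M" "y \<in> ball x e" for y
  proof -
    have "s * ?h y > 0" "y \<in> G" using e(2) y by auto
    have "sgn r = s" if "s * r > 0" for r
      using that ss by (auto simp: square_eq_1_iff)
    then have "sgn (?h y) = s" using \<open>s * ?h y > 0\<close> by blast
    then show ?thesis using unit_normal_unique[OF c N y(1)] \<open>y \<in> G\<close> unfolding G_def by auto
  qed
  have dN: "frechet_derivative N' (at x) v = s *\<^sub>R frechet_derivative N (at x) v" if v: "height \<phi> x v = 0" for v
  proof -
    obtain \<delta> \<gamma> \<gamma>' a where \<gamma>: "\<delta> > 0" "\<gamma> 0 = x" "\<gamma>' 0 = v" "\<And>t. \<bar>t\<bar> < \<delta> \<Longrightarrow> \<gamma> t \<in> M"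
      "\<And>t. \<bar>t\<bar> < \<delta> \<Longrightarrow> (\<gamma> has_vector_derivative \<gamma>' t) (at t)"
      using surface_curve[OF c xU v[unfolded height_def]] by metis
    have gd: "(\<gamma> has_vector_derivative v) (at 0)" using \<gamma>(1,3) \<gamma>(5)[of 0] by simp
    have chain: "((\<lambda>t. F (\<gamma> t)) has_vector_derivative frechet_derivative F (at x) v) (at 0)"
      if "smooth_on X F" "x \<in> X" for F :: "real^3 \<Rightarrow> real^3" and X
      using smooth_on_along_curve[OF that(1) _ gd] that(2) \<gamma>(2) by simp
    have "isCont \<gamma> 0" using gd has_vector_derivative_continuous by blast
    then have "eventually (\<lambda>t. \<gamma> t \<in> ball x e) (at 0)"
      using \<gamma>(2) e(1) by (metis isCont_def tendsto_def topological_tendstoD centre_in_ball open_ball)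
    moreover have "eventually (\<lambda>t. \<bar>t\<bar> < \<delta>) (at (0::real))"
      using \<gamma>(1) by (auto simp: eventually_at intro!: exI[of _ \<delta>])
    ultimately have ev: "eventually (\<lambda>t. N' (\<gamma> t) = s *\<^sub>R N (\<gamma> t)) (at 0)"
      by eventually_elim (use near \<gamma>(4) in blast)
    have at0: "N' (\<gamma> 0) = s *\<^sub>R N (\<gamma> 0)" using near[of x] xU(2) e(1) \<gamma>(2) by simp
    have "((\<lambda>t. s *\<^sub>R N (\<gamma> t)) has_vector_derivative frechet_derivative N' (at x) v) (at 0)"
      using has_derivative_transform_eventually[OF
          chain[OF unit_normalD(2)[OF N(2)] x(3), unfolded has_vector_derivative_def] ev at0 UNIV_I]
      unfolding has_vector_derivative_def .
    moreover have "((\<lambda>t. s *\<^sub>R N (\<gamma> t)) has_vector_derivative s *\<^sub>R frechet_derivative N (at x) v) (at 0)"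
      using chain[OF unit_normalD(2)[OF N(1)] x(2)]
      by (rule bounded_linear.has_vector_derivative[OF bounded_linear_scaleR_right])
    ultimately show ?thesis by (rule vector_derivative_unique_at)
  qed
  have "sol_mean_curvature N' x = s * sol_mean_curvature N x"
    using near[of x] xU e(1) dN height_tangential[OF c N(1) xU(2,1) x(2)]
    by (intro sol_mean_curvature_sign_change[OF _ ss]) auto
  moreover have "N' x = s *\<^sub>R N x" using near[of x] xU e(1) by simp
  moreover have "sgn s = s" using ss unfolding s_def by simp
  ultimately show ?thesis using ss by (simp add: sgn_mult)
qed

section \<open>Comparison with the coordinate planes\<close>

lemma local_max_derivatives:
  fixes f f' :: "real \<Rightarrow> real"
  assumes d: "d > 0" and f: "\<And>t. \<bar>t\<bar> < d \<Longrightarrow> (f has_real_derivative f' t) (at t)"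
    and f': "(f' has_real_derivative a) (at 0)" and max: "\<And>t. \<bar>t\<bar> < d \<Longrightarrow> f t \<le> f 0"
  shows "f' 0 = 0" "a \<le> 0"
proof -
  show z: "f' 0 = 0"
    by (rule DERIV_local_max[OF f[of 0] d]) (use d max in auto)
  show "a \<le> 0"
  proof (rule ccontr)
    assume "\<not> a \<le> 0"
    then obtain e where e: "e > 0" "\<And>h. 0 < h \<Longrightarrow> h < e \<Longrightarrow> f' 0 < f' (0 + h)"
      using DERIV_pos_inc_right[OF f'] by auto
    define t where "t = min d e / 2"
    have t: "0 < t" "t < d" "t < e" unfolding t_def using d e(1) by auto
    obtain u where u: "0 < u" "u < t" "f t - f 0 = (t - 0) * f' u"
      using MVT2[of 0 t f f'] t f by force
    have "f' u > 0" using e(2)[of u] u t z by simp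
    then have "f t - f 0 > 0" using u t by simp
    then show False using max[of t] t by simp
  qed
qed

lemma has_real_derivative_component:
  "(f has_vector_derivative f') F \<Longrightarrow> ((\<lambda>t. f t $ i) has_real_derivative f' $ i) F"
  unfolding has_real_derivative_iff_has_vector_derivative
  by (rule bounded_linear.has_vector_derivative[OF bounded_linear_vec_nth])

text \<open>Differentiate \<open>g(N, \<gamma>') = 0\<close> along a curve \<open>\<gamma>\<close> on the surface with \<open>\<gamma>(0) = x\<close> and \<open>\<gamma>'(0) = v\<close>; \<open>a\<close>
is its second derivative at \<open>0\<close>, and the last summand comes from the derivatives of the metric
coefficients. The signed coordinate \<open>s x\<^sub>k\<close> has a maximum along \<open>\<gamma>\<close> at \<open>0\<close>.\<close>

lemma extremum_curve:
  assumes c: "slice_chart M flat_model U V \<phi> \<psi>" and x: "x \<in> U" "x \<in> M" "x \<in> W"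
    and N: "sol_unit_normal_on M W N" and v: "height \<phi> x v = 0"
    and max: "\<And>y. y \<in> M \<Longrightarrow> s * y$k \<le> s * x$k" and s: "s \<noteq> 0"
  shows "v$k = 0 \<and> (\<exists>a. s * a$k \<le> 0 \<and>
    sol_metric x (frechet_derivative N (at x) v) v + sol_metric x (N x) a
      + 2 * v$3 * (exp (2 * x$3) * N x $ 1 * v$1 - exp (- 2 * x$3) * N x $ 2 * v$2) = 0)"
proof -
  obtain \<delta> \<gamma> \<gamma>' a where \<gamma>: "\<delta> > 0" "\<gamma> 0 = x" "\<gamma>' 0 = v"
    "\<And>t. \<bar>t\<bar> < \<delta> \<Longrightarrow> \<gamma> t \<in> M" "\<And>t. \<bar>t\<bar> < \<delta> \<Longrightarrow> \<gamma>' t \<in> surface_tangent M (\<gamma> t)"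
    "\<And>t. \<bar>t\<bar> < \<delta> \<Longrightarrow> (\<gamma> has_vector_derivative \<gamma>' t) (at t)"
    "(\<gamma>' has_vector_derivative a) (at 0)"
    using surface_curve[OF c x(1,2) v[unfolded height_def]] by metis
  have d1: "((\<lambda>t. s * \<gamma> t $ k) has_real_derivative s * \<gamma>' t $ k) (at t)" if "\<bar>t\<bar> < \<delta>" for t
    by (rule DERIV_cmult[OF has_real_derivative_component[OF \<gamma>(6)[OF that]]])
  have d2: "((\<lambda>t. s * \<gamma>' t $ k) has_real_derivative s * a $ k) (at 0)"
    by (rule DERIV_cmult[OF has_real_derivative_component[OF \<gamma>(7)]])
  have m: "s * \<gamma> t $ k \<le> s * \<gamma> 0 $ k" if "\<bar>t\<bar> < \<delta>" for t
    unfolding \<gamma>(2) by (rule max[OF \<gamma>(4)[OF that]])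
  have "s * \<gamma>' 0 $ k = 0" by (rule local_max_derivatives(1)[OF \<gamma>(1) d1 d2 m])
  have "s * a$k \<le> 0" by (rule local_max_derivatives(2)[OF \<gamma>(1) d1 d2 m])
  have gd: "(\<gamma> has_vector_derivative v) (at 0)" using \<gamma>(1,3) \<gamma>(6)[of 0] by simp
  have nd: "((\<lambda>t. N (\<gamma> t)) has_vector_derivative frechet_derivative N (at x) v) (at 0)"
    using smooth_on_along_curve[OF unit_normalD(2)[OF N] _ gd] \<gamma>(2) x(3) by simp
  let ?F = "\<lambda>t. sol_metric (\<gamma> t) (N (\<gamma> t)) (\<gamma>' t)"
  let ?D = "sol_metric x (frechet_derivative N (at x) v) v + sol_metric x (N x) a
      + 2 * v$3 * (exp (2 * x$3) * N x $ 1 * v$1 - exp (- 2 * x$3) * N x $ 2 * v$2)"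
  note comps = has_real_derivative_component[OF gd] has_real_derivative_component[OF nd] has_real_derivative_component[OF \<gamma>(7)]
  have FD: "(?F has_real_derivative ?D) (at 0)"
    unfolding sol_metric_def
    by (auto intro!: derivative_eq_intros comps simp: \<gamma>(2,3) algebra_simps)
  have ev: "eventually (\<lambda>t. ?F t = 0) (at 0)"
  proof -
    have "isCont \<gamma> 0" using gd has_vector_derivative_continuous by blast
    then have "eventually (\<lambda>t. \<gamma> t \<in> W) (at 0)"
      using topological_tendstoD[OF _ unit_normalD(1)[OF N]] x(3) \<gamma>(2) unfolding isCont_def by simp
    moreover have "eventually (\<lambda>t. \<bar>t\<bar> < \<delta>) (at (0::real))"
      using \<gamma>(1) by (auto simp: eventually_at intro!: exI[of _ \<delta>])
    ultimately show ?thesis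
      by eventually_elim (use \<gamma>(4,5) unit_normalD(5)[OF N] in blast)
  qed
  have F0: "?F 0 = 0" using \<gamma>(1) \<gamma>(4)[of 0] \<gamma>(5)[of 0] unit_normalD(5)[OF N] \<gamma>(2) x(3) by auto
  have "((\<lambda>t::real. 0::real) has_real_derivative ?D) (at 0)"
    using has_derivative_transform_eventually[OF FD[unfolded has_field_derivative_def] ev F0 UNIV_I]
    unfolding has_field_derivative_def .
  then have "?D = 0" using DERIV_unique DERIV_const by blast
  then show ?thesis using \<open>s * \<gamma>' 0 $ k = 0\<close> \<open>s * a$k \<le> 0\<close> s \<gamma>(3) by auto
qed

lemma axis_component: "axis i 1 $ j = (if j = i then 1 else 0)"
  by (simp add: axis_def)

text \<open>At an extremum of \<open>x\<^sub>k\<close> the tangent plane is \<open>v\<^sub>k = 0\<close> and \<open>N\<close> is a multiple of the \<open>k\<close>-th coordinate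
vector. Summing the identity of \<open>extremum_curve\<close> over an orthogonal basis of the tangent plane turns
\<open>2 H\<close> into \<open>N\<^sub>k\<close> times a combination, with positive coefficients, of second derivatives of \<open>x\<^sub>k\<close> along
curves, each of which vanishes or has the sign opposite to \<open>s\<close>. There is no further term because the coordinate
planes are minimal: for \<open>k = 1\<close> the Christoffel terms vanish on the tangent plane, and for \<open>k = 3\<close> the two
contributions \<open>N\<^sub>3\<close> and \<open>- N\<^sub>3\<close> cancel.\<close>

lemma mean_curvature_at_extremum:
  assumes p: "p \<in> surface_interior M" "p \<in> W" and N: "sol_unit_normal_on M W N"
    and H: "sol_mean_curvature N p \<noteq> 0"
    and max: "\<And>y. y \<in> M \<Longrightarrow> s * y$k \<le> s * p$k" and s: "s * s = 1" and k: "k = 1 \<or> k = 3"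
  shows "s * (sgn (sol_mean_curvature N p) * N p $ k) < 0"
proof -
  obtain U V \<phi> \<psi> where c: "slice_chart M flat_model U V \<phi> \<psi>" and pU: "p \<in> U" "p \<in> M"
    using p(1) unfolding surface_interior_def by blast
  have s0: "s \<noteq> 0" using s by auto
  let ?dN = "frechet_derivative N (at p)"
  note ext = extremum_curve[OF c pU p(2) N _ max s0]
  have vk: "v$k = height \<phi> p v / height \<phi> p (N p) * N p $ k" for v
    using conjunct1[OF ext[OF height_normal_split[OF c N pU(2,1) p(2), of v]]] by simp
  have Nk: "N p $ k \<noteq> 0" using vk[of "axis k 1"] by auto
  have tan: "height \<phi> p v = 0" if "v$k = 0" for v
    using vk[of v] that Nk height_normal_nonzero[OF c N pU(2,1) p(2)] by simp
  have orth: "sol_metric p (N p) v = 0" if "v$k = 0" for v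
    using metric_normal[OF c N pU(2,1) p(2)] tan[OF that] by simp
  have unit: "sol_metric p (N p) (N p) = 1" using unit_normalD(4)[OF N pU(2) p(2)] .
  have "\<exists>b. s * b \<le> 0 \<and> 2 * sol_mean_curvature N p = N p $ k * b"
    using k
  proof
    assume k1: "k = 1"
    have N0: "N p $ 2 = 0" "N p $ 3 = 0"
      using orth[of "axis 2 1"] orth[of "axis 3 1"] by (auto simp: k1 axis_component sol_metric_def)
    have N1: "exp (2 * p$3) * (N p $ 1 * N p $ 1) = 1" using unit by (simp add: sol_metric_def N0)
    have T: "tangential N p (axis 1 1) = 0" "tangential N p (axis 2 1) = axis 2 1" "tangential N p (axis 3 1) = axis 3 1"
      using N1 by (auto simp: tangential_def sol_metric_def vec_eq_iff forall_3 axis_component N0 mult_ac)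
    obtain a :: "real^3" where a: "s * a$1 \<le> 0" "exp (- 2 * p$3) * ?dN (axis 2 1) $ 2 + exp (2 * p$3) * N p $ 1 * a$1 = 0"
      using ext[OF tan, of "axis 2 1"] by (auto simp: k1 axis_component sol_metric_def N0)
    obtain b :: "real^3" where b: "s * b$1 \<le> 0" "?dN (axis 3 1) $ 3 + exp (2 * p$3) * N p $ 1 * b$1 = 0"
      using ext[OF tan, of "axis 3 1"] by (auto simp: k1 axis_component sol_metric_def N0)
    have l: "?dN 0 = 0"
      using smooth_on_has_derivative[OF unit_normalD(2)[OF N] p(2)] has_derivative_linear linear_0 by blast
    have "2 * sol_mean_curvature N p = - ?dN (axis 2 1) $ 2 - ?dN (axis 3 1) $ 3"
      unfolding sol_mean_curvature_eq sum_3 T sol_covariant_deriv_eq by (simp add: l axis_component N0)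
    also have "\<dots> = N p $ 1 * (exp (2 * p$3) * exp (2 * p$3) * a$1 + exp (2 * p$3) * b$1)"
    proof -
      have "?dN (axis 2 1) $ 2 = exp (2 * p$3) * (exp (- 2 * p$3) * ?dN (axis 2 1) $ 2)"
        by (simp add: mult.assoc[symmetric] flip: exp_add)
      also have "\<dots> = - (exp (2 * p$3) * (exp (2 * p$3) * N p $ 1 * a$1))" using a(2) by (simp add: eq_neg_iff_add_eq_0 flip: distrib_left)
      finally show ?thesis using b(2) by (simp add: algebra_simps)
    qed
    finally have "2 * sol_mean_curvature N p = N p $ 1 * (exp (2 * p$3) * exp (2 * p$3) * a$1 + exp (2 * p$3) * b$1)" .
    moreover have "s * (exp (2 * p$3) * exp (2 * p$3) * a$1 + exp (2 * p$3) * b$1) =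
        exp (2 * p$3) * exp (2 * p$3) * (s * a$1) + exp (2 * p$3) * (s * b$1)" by (simp add: algebra_simps)
    moreover have "\<dots> \<le> 0" 
      by (intro add_nonpos_nonpos mult_nonneg_nonpos[OF _ a(1)] mult_nonneg_nonpos[OF _ b(1)]) auto
    ultimately show ?thesis unfolding k1 by metis
  next
    assume k3: "k = 3"
    have N0: "N p $ 1 = 0" "N p $ 2 = 0"
      using orth[of "axis 1 1"] orth[of "axis 2 1"] by (auto simp: k3 axis_component sol_metric_def)
    have N3: "N p $ 3 * N p $ 3 = 1" using unit by (simp add: sol_metric_def N0)
    have T: "tangential N p (axis 1 1) = axis 1 1" "tangential N p (axis 2 1) = axis 2 1" "tangential N p (axis 3 1) = 0"
      using N3 by (auto simp: tangential_def sol_metric_def vec_eq_iff forall_3 axis_component N0)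
    obtain a :: "real^3" where a: "s * a$3 \<le> 0" "exp (2 * p$3) * ?dN (axis 1 1) $ 1 + N p $ 3 * a$3 = 0"
      using ext[OF tan, of "axis 1 1"] by (auto simp: k3 axis_component sol_metric_def N0)
    obtain b :: "real^3" where b: "s * b$3 \<le> 0" "exp (- 2 * p$3) * ?dN (axis 2 1) $ 2 + N p $ 3 * b$3 = 0"
      using ext[OF tan, of "axis 2 1"] by (auto simp: k3 axis_component sol_metric_def N0)
    have l: "?dN 0 = 0"
      using smooth_on_has_derivative[OF unit_normalD(2)[OF N] p(2)] has_derivative_linear linear_0 by blast
    have "2 * sol_mean_curvature N p = - ?dN (axis 1 1) $ 1 - ?dN (axis 2 1) $ 2"
      unfolding sol_mean_curvature_eq sum_3 T sol_covariant_deriv_eq by (simp add: l axis_component N0)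
    also have "\<dots> = N p $ 3 * (exp (- 2 * p$3) * a$3 + exp (2 * p$3) * b$3)"
    proof -
      have e: "exp (2 * p$3) * ?dN (axis 1 1) $ 1 = - (N p $ 3 * a$3)"
        "exp (- 2 * p$3) * ?dN (axis 2 1) $ 2 = - (N p $ 3 * b$3)" using a(2) b(2) by linarith+
      have f: "?dN (axis 1 1) $ 1 = exp (- 2 * p$3) * (exp (2 * p$3) * ?dN (axis 1 1) $ 1)"
        "?dN (axis 2 1) $ 2 = exp (2 * p$3) * (exp (- 2 * p$3) * ?dN (axis 2 1) $ 2)"
        by (simp_all add: mult.assoc[symmetric] flip: exp_add)
      show ?thesis using f[unfolded e] by (simp add: algebra_simps)
    qed
    finally have "2 * sol_mean_curvature N p = N p $ 3 * (exp (- 2 * p$3) * a$3 + exp (2 * p$3) * b$3)" .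
    moreover have "s * (exp (- 2 * p$3) * a$3 + exp (2 * p$3) * b$3) =
        exp (- 2 * p$3) * (s * a$3) + exp (2 * p$3) * (s * b$3)" by (simp add: algebra_simps)
    moreover have "\<dots> \<le> 0" 
      by (intro add_nonpos_nonpos mult_nonneg_nonpos[OF _ a(1)] mult_nonneg_nonpos[OF _ b(1)]) auto
    ultimately show ?thesis unfolding k3 by metis
  qed
  then obtain b where b: "s * b \<le> 0" "2 * sol_mean_curvature N p = N p $ k * b" by blast
  let ?H = "sol_mean_curvature N p"
  have "\<bar>?H\<bar> * (s * (sgn ?H * N p $ k)) = s * ((sgn ?H * \<bar>?H\<bar>) * N p $ k)"
    by (simp only: mult_ac)
  also have "\<dots> = s * (?H * N p $ k)" unfolding sgn_mult_abs ..
  also have "\<dots> = (N p $ k)\<^sup>2 * (s * b) / 2"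
    using b(2) by (simp add: power2_eq_square field_simps)
  also have "\<dots> \<le> 0" using b(1) by (simp add: mult_nonneg_nonpos)
  finally have "s * (sgn ?H * N p $ k) \<le> 0" using H by (simp add: mult_le_0_iff)
  moreover have "s * (sgn ?H * N p $ k) \<noteq> 0" using s0 H Nk by (simp add: sgn_zero_iff)
  ultimately show ?thesis by linarith
qed

text \<open>The vector \<open>- sgn(H) N\<close> at \<open>x\<close> points into \<open>A\<close>. By \<open>mean_curvature_normal_unique\<close> it does not depend
on the choice of \<open>N\<close>.\<close>

definition normal_side :: "(real^3) set \<Rightarrow> (real^3) set \<Rightarrow> real^3 \<Rightarrow> bool" where
  "normal_side M A x \<longleftrightarrow> (\<exists>W N. x \<in> W \<and> sol_unit_normal_on M W N \<and> sol_mean_curvature N x \<noteq> 0 \<and>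
     (\<forall>\<^sub>F t in at_right 0. x - t *\<^sub>R (sgn (sol_mean_curvature N x) *\<^sub>R N x) \<in> A))"

lemma normal_side_exclusive:
  assumes x: "x \<in> surface_interior M" and AB: "A \<inter> B = {}"
    and sides: "normal_side M A x" "normal_side M B x"
  shows False
proof -
  obtain W N where 1: "x \<in> W" "sol_unit_normal_on M W N"
     "\<forall>\<^sub>F t in at_right 0. x - t *\<^sub>R (sgn (sol_mean_curvature N x) *\<^sub>R N x) \<in> A"
    using sides(1) unfolding normal_side_def by blast
  obtain W' N' where 2: "x \<in> W'" "sol_unit_normal_on M W' N'"
     "\<forall>\<^sub>F t in at_right 0. x - t *\<^sub>R (sgn (sol_mean_curvature N' x) *\<^sub>R N' x) \<in> B"
    using sides(2) unfolding normal_side_def by blast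
  have "\<forall>\<^sub>F t in at_right (0::real). False"
    using 1(3) 2(3) unfolding mean_curvature_normal_unique[OF x 1(1) 2(1) 1(2) 2(2)]
    by eventually_elim (use AB in blast)
  then show False by simp
qed

text \<open>In a flat chart around \<open>x\<close>, the vector \<open>- sgn(H) N\<close> points to the half where the third chart
coordinate has a fixed sign, since neither \<open>H\<close> nor the height of \<open>N\<close> vanishes near \<open>x\<close>. This half is
connected, so it lies on one side of the splitting.\<close>

lemma normal_side_locally_constant:
  assumes nv: "nonvanishing_mean_curvature M" and spl: "splits M U A B"
    and x: "x \<in> surface_interior M" "x \<in> U"
  obtains G where "open G" "x \<in> G" "(\<forall>y\<in>G \<inter> M. normal_side M A y) \<or> (\<forall>y\<in>G \<inter> M. normal_side M B y)"
proof -
  obtain U' V \<phi> \<psi> where c: "slice_chart M flat_model U' V \<phi> \<psi>" and xU: "x \<in> U'" "x \<in> M"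
    using x(1) unfolding surface_interior_def by blast
  obtain W N where W: "x \<in> W" and N: "sol_unit_normal_on M W N" and H: "sol_mean_curvature N x \<noteq> 0"
    using nv xU(2) unfolding nonvanishing_mean_curvature_def by blast
  have "open (U \<inter> W)" using splitsD(1)[OF spl] unit_normalD(1)[OF N] by blast
  then obtain G where G: "x \<in> G" "G \<subseteq> U \<inter> W" "G \<subseteq> U'"
    "splits M G {z \<in> G. \<phi> z $ 3 > 0} {z \<in> G. \<phi> z $ 3 < 0}"
    "connected {z \<in> G. \<phi> z $ 3 > 0}" "connected {z \<in> G. \<phi> z $ 3 < 0}"
    by (rule flat_chart_splits[OF c _ _ xU]) (use x W that in blast)+
  have oG: "open G" using splitsD(1)[OF G(4)] .
  define h where "h y = sol_mean_curvature N y * height \<phi> y (N y)" for y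
  define s where "s = sgn (h x)"
  have hx: "h x \<noteq> 0" unfolding h_def using H height_normal_nonzero[OF c N xU(2,1) W] by simp
  have s1: "s = 1 \<or> s = -1" unfolding s_def using hx by (auto simp: sgn_if)
  have "continuous_on G (sol_mean_curvature N)"
    using continuous_on_sol_mean_curvature[OF unit_normalD(2)[OF N]]
    by (rule continuous_on_subset) (use G(2) in blast)
  moreover have "continuous_on G (\<lambda>y. height \<phi> y (N y))"
    using continuous_on_height_normal[OF c N] by (rule continuous_on_subset) (use G in blast)
  ultimately have "continuous_on G h" unfolding h_def by (rule continuous_on_mult)
  then have "continuous_on G (\<lambda>y. s * h y)" by (rule continuous_on_mult_left)
  then have oG': "open (G \<inter> (\<lambda>y. s * h y) -` {0<..})" (is "open ?G'")
    using continuous_open_preimage[OF _ oG open_greaterThan] by blast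
  have xG': "x \<in> ?G'" using G(1) s1 hx abs_sgn[of "h x"] unfolding s_def
    by (metis IntI greaterThan_iff mult.commute vimageI zero_less_abs_iff)
  define Q where "Q = {z \<in> G. s * \<phi> z $ 3 < 0}"
  have side: "\<forall>\<^sub>F t in at_right 0. y - t *\<^sub>R (sgn (sol_mean_curvature N y) *\<^sub>R N y) \<in> Q"
    if y: "y \<in> ?G'" "y \<in> M" for y
  proof -
    let ?n = "sgn (sol_mean_curvature N y) *\<^sub>R N y"
    define g where "g t = y + t *\<^sub>R (- ?n)" for t :: real
    have yU: "y \<in> G" "y \<in> U'" "y \<in> W" using y(1) G by auto
    have gd: "(g has_vector_derivative (- ?n)) (at 0)" unfolding g_def by (auto intro!: derivative_eq_intros)
    have g0: "g 0 = y" unfolding g_def by simp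
    have "((\<lambda>t. \<phi> (g t)) has_vector_derivative frechet_derivative \<phi> (at (g 0)) (- ?n)) (at 0)"
      using yU g0 by (intro smooth_on_along_curve[OF slice_chartD(3)[OF c] _ gd]) simp
    from has_real_derivative_component[OF this, of 3]
    have "((\<lambda>t. \<phi> (g t) $ 3) has_real_derivative height \<phi> y (- ?n)) (at 0)"
      unfolding height_def g0 .
    then have der: "((\<lambda>t. - s * \<phi> (g t) $ 3) has_real_derivative - s * height \<phi> y (- ?n)) (at 0)"
      by (rule DERIV_cmult)
    have l: "linear (height \<phi> y)" by (rule linear_height[OF c yU(2)])
    have hy: "s * h y > 0" using y(1) by auto
    then have Hy: "sol_mean_curvature N y \<noteq> 0" unfolding h_def by auto
    have "- s * height \<phi> y (- ?n) = s * (sgn (sol_mean_curvature N y) * height \<phi> y (N y))"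
      by (simp add: linear_neg[OF l] linear_scale[OF l])
    then have "\<bar>sol_mean_curvature N y\<bar> * (- s * height \<phi> y (- ?n)) =
        s * ((sgn (sol_mean_curvature N y) * \<bar>sol_mean_curvature N y\<bar>) * height \<phi> y (N y))"
      by (simp only: mult_ac)
    then have "\<bar>sol_mean_curvature N y\<bar> * (- s * height \<phi> y (- ?n)) = s * h y"
      unfolding h_def sgn_mult_abs .
    then have "- s * height \<phi> y (- ?n) > 0" using hy Hy by (metis abs_ge_zero order.order_iff_strict zero_less_mult_pos mult_zero_left)
    then obtain d where d: "d > 0" "\<And>t. 0 < t \<Longrightarrow> t < d \<Longrightarrow> - s * \<phi> (g 0) $ 3 < - s * \<phi> (g (0 + t)) $ 3"
      using DERIV_pos_inc_right[OF der] by auto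
    have "\<phi> y $ 3 = 0" using slice_chartD(11)[OF c yU(2)] y(2) by (simp add: flat_model_def)
    then have "s * \<phi> (g t) $ 3 < 0" if "0 < t" "t < d" for t using d(2)[OF that] g0 by simp
    then have e1: "\<forall>\<^sub>F t in at_right 0. s * \<phi> (g t) $ 3 < 0"
      unfolding eventually_at_right_field using d(1) by blast
    have "isCont g 0" using gd has_vector_derivative_continuous by blast
    then have "\<forall>\<^sub>F t in at 0. g t \<in> G"
      using topological_tendstoD[OF _ oG] yU(1) g0 unfolding isCont_def by simp
    then have "\<forall>\<^sub>F t in at_right 0. g t \<in> G" using eventually_at_split by blast
    with e1 show ?thesis
      by eventually_elim (simp add: Q_def g_def)
  qed
  have "Q = {z \<in> G. \<phi> z $ 3 < 0} \<or> Q = {z \<in> G. \<phi> z $ 3 > 0}" unfolding Q_def using s1 by auto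
  then have "connected Q" "Q \<subseteq> G - M" using G(5,6) splitsD(5)[OF G(4)] by auto
  then have "Q \<subseteq> A \<or> Q \<subseteq> B" using splits_subset_connected[OF spl, of Q] G(2) by blast
  moreover have "normal_side M Z y" if y: "y \<in> ?G'" "y \<in> M" and Z: "Q \<subseteq> Z" for y Z
  proof -
    have "sol_mean_curvature N y \<noteq> 0" "y \<in> W" using y(1) G(2) unfolding h_def by auto
    moreover have "\<forall>\<^sub>F t in at_right 0. y - t *\<^sub>R (sgn (sol_mean_curvature N y) *\<^sub>R N y) \<in> Z"
      using side[OF y] by eventually_elim (use Z in blast)
    ultimately show ?thesis unfolding normal_side_def using N by blast
  qed
  ultimately have "(\<forall>y\<in>?G' \<inter> M. normal_side M A y) \<or> (\<forall>y\<in>?G' \<inter> M. normal_side M B y)" by blast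
  then show ?thesis using that[OF oG' xG'] by blast
qed

lemma normal_side_constant:
  assumes nv: "nonvanishing_mean_curvature M" and spl: "splits M U A B"
    and S: "connected S" "S \<subseteq> surface_interior M" "S \<subseteq> U"
  shows "(\<forall>x\<in>S. normal_side M A x) \<or> (\<forall>x\<in>S. normal_side M B x)"
proof -
  define P where "P Z = \<Union>{G. open G \<and> (\<forall>y\<in>G \<inter> M. normal_side M Z y)}" for Z
  have o: "open (P A)" "open (P B)" unfolding P_def by auto
  have sub: "S \<subseteq> P A \<union> P B"
  proof
    fix x assume "x \<in> S"
    then have "x \<in> surface_interior M" "x \<in> U" using S by auto
    from normal_side_locally_constant[OF nv spl this] obtain G
      where "open G" "x \<in> G" "(\<forall>y\<in>G \<inter> M. normal_side M A y) \<or> (\<forall>y\<in>G \<inter> M. normal_side M B y)" .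
    then show "x \<in> P A \<union> P B" unfolding P_def by blast
  qed
  have SM: "S \<subseteq> M" using S(2) unfolding surface_interior_def by blast
  have P: "normal_side M Z x" if x: "x \<in> P Z" "x \<in> S" for Z x
  proof -
    obtain G where "x \<in> G" "\<forall>y\<in>G \<inter> M. normal_side M Z y" using x(1) unfolding P_def by blast
    then show ?thesis using SM x(2) by blast
  qed
  have "P A \<inter> P B \<inter> S = {}"
  proof (rule ccontr)
    assume "P A \<inter> P B \<inter> S \<noteq> {}"
    then obtain x where x: "x \<in> P A" "x \<in> P B" "x \<in> S" by blast
    show False
      using normal_side_exclusive[OF _ splitsD(4)[OF spl] P[OF x(1,3)] P[OF x(2,3)]] S(2) x(3) by blast
  qed
  from connectedD[OF S(1) o this sub] have "S \<subseteq> P A \<or> S \<subseteq> P B" using sub by fast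
  then show ?thesis using P by (meson subsetD)
qed

section \<open>Coordinate planes and the conclusion\<close>

text \<open>The Jordan curve theorem, carried over from the complex plane by the isometry \<open>g\<close> with inverse \<open>h\<close>. The
inner domain is recognised as \<^const>\<open>bounded_domain\<close> because \<open>g\<close> and \<open>h\<close> preserve boundedness and
connectedness.\<close>

lemma coordinate_plane_jordan:
  fixes C :: "(real^3) set"
  assumes C: "simple_closed_curve C" "C \<subseteq> {p. p$k = 0}"
  defines "D \<equiv> bounded_domain {p. p$k = 0} C"
  obtains T i where "connected D" "connected T" "D \<union> T = {p. p$k = 0} - C"
    "T \<subseteq> ext_in {p. p$k = 0} D" "i \<noteq> k" "\<And>c. \<exists>r\<in>T. r$i > c"
proof -
  let ?Q = "{p::real^3. p$k = 0}"
  obtain i j where ij: "i \<noteq> k" "j \<noteq> k" "i \<noteq> j" "\<And>l. l = i \<or> l = j \<or> l = k"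
  proof -
    consider "k = 1" | "k = 2" | "k = 3" using exhaust_3[of k] by blast
    then show ?thesis
    proof cases
      case 1 then show ?thesis using that[of 2 3] exhaust_3 by auto
    next
      case 2 then show ?thesis using that[of 1 3] exhaust_3 by auto
    next
      case 3 then show ?thesis using that[of 1 2] exhaust_3 by auto
    qed
  qed
  define h where "h p = Complex (p$i) (p$j)" for p :: "real^3"
  define g where "g z = (\<chi> l. if l = i then Re z else if l = j then Im z else 0)" for z
  have hg: "h (g z) = z" for z using ij(3) by (simp add: h_def g_def)
  have gh: "g (h p) = p" if "p \<in> ?Q" for p
    using ij that by (auto simp: h_def g_def vec_eq_iff)
  have gQ: "g z \<in> ?Q" for z using ij(1,2) by (simp add: g_def)
  have ch: "continuous_on X h" for X unfolding h_def by (intro continuous_intros)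
  have cg: "continuous_on X g" for X
    unfolding g_def
  proof (rule continuous_on_vec_lambda)
    fix l show "continuous_on X (\<lambda>z. if l = i then Re z else if l = j then Im z else 0)"
      by (cases "l = i"; cases "l = j") (auto intro!: continuous_intros)
  qed
  have h_bound: "norm (h p) \<le> norm (p$i) + norm (p$j)" for p unfolding h_def by (simp add: complex_norm sqrt_sum_squares_le_sum_abs)
  have bh: "bounded (h ` X)" if "bounded X" for X
  proof -
    obtain b where b: "\<And>x. x \<in> X \<Longrightarrow> norm x \<le> b" using \<open>bounded X\<close> bounded_iff by blast
    have "norm (h x) \<le> 2 * b" if "x \<in> X" for x
      using h_bound[of x] b[OF that] component_le_norm_cart[of x i] component_le_norm_cart[of x j] by simp
    then show ?thesis unfolding bounded_iff by blast
  qed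
  have bg: "bounded (g ` X)" if "bounded X" for X
  proof (rule bounded_subset)
    show "bounded (g ` closure X)"
      using that by (intro compact_imp_bounded compact_continuous_image cg) (simp add: compact_closure)
    show "g ` X \<subseteq> g ` closure X" using closure_subset by blast
  qed
  obtain c where c: "simple_path c" "pathfinish c = pathstart c" "path_image c = C"
    using C(1) unfolding simple_closed_curve_def by blast
  define J where "J = path_image (h \<circ> c)"
  have JC: "J = h ` C" unfolding J_def c(3)[symmetric] by (rule path_image_compose)
  have "inj_on h C" using gh C(2) by (intro inj_on_inverseI[where g = g]) blast
  then have sp: "simple_path (h \<circ> c)" using simple_path_continuous_image[OF c(1) ch] c(3) by blast
  have "pathfinish (h \<circ> c) = pathstart (h \<circ> c)" using c(2) by (simp add: pathfinish_compose pathstart_compose)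
  note jordan = Jordan_inside_outside[OF sp this, folded J_def]
  have gJ: "g z \<in> C \<longleftrightarrow> z \<in> J" for z
    unfolding JC using hg gh C(2) by (metis (no_types, lifting) image_iff subsetD)
  have split: "g ` inside J \<union> g ` outside J = ?Q - C"
  proof
    show "g ` inside J \<union> g ` outside J \<subseteq> ?Q - C" using gQ gJ jordan by blast
    show "?Q - C \<subseteq> g ` inside J \<union> g ` outside J"
    proof
      fix p assume p: "p \<in> ?Q - C"
      then have "p = g (h p)" using gh by simp
      then have "h p \<in> inside J \<union> outside J" using gJ[of "h p"] p jordan by auto
      then show "p \<in> g ` inside J \<union> g ` outside J" using \<open>p = g (h p)\<close> by blast
    qed
  qed
  have con: "connected (g ` inside J)" "connected (g ` outside J)"
    using jordan cg by (blast intro: connected_continuous_image)+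
  have D_eq: "D = g ` inside J"
  proof
    show "D \<subseteq> g ` inside J"
    proof
      fix p assume p: "p \<in> D"
      then have pQ: "p \<in> ?Q - C" and b: "bounded (connected_component_set (?Q - C) p)"
        unfolding D_def bounded_domain_def by auto
      show "p \<in> g ` inside J"
      proof (rule ccontr)
        assume "p \<notin> g ` inside J"
        then have "p \<in> g ` outside J" using split pQ by blast
        then have "g ` outside J \<subseteq> connected_component_set (?Q - C) p"
          using con(2) split by (intro connected_component_maximal) auto
        then have "bounded (h ` g ` outside J)" using b bounded_subset bh by blast
        then show False using jordan by (simp add: image_image hg)
      qed
    qed
    show "g ` inside J \<subseteq> D"
    proof
      fix p assume p: "p \<in> g ` inside J"
      let ?X = "connected_component_set (?Q - C) p"
      have "connected (h ` ?X)" by (intro connected_continuous_image ch connected_connected_component)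
      moreover have XQ: "?X \<subseteq> ?Q - C" by (rule connected_component_subset)
      have "h ` ?X \<subseteq> inside J \<union> outside J"
      proof -
        have "h x \<in> - J" if "x \<in> ?X" for x
        proof -
          have "x \<in> ?Q" "x \<notin> C" using XQ that by auto
          then show ?thesis using gJ[of "h x"] gh[of x] by simp
        qed
        then show ?thesis using jordan by blast
      qed
      moreover have "p \<in> ?X" using p split by auto
      then have hp: "h p \<in> h ` ?X \<inter> inside J" using p hg by auto
      moreover have "inside J \<inter> outside J \<inter> h ` ?X = {}" using jordan by auto
      ultimately have "inside J \<inter> h ` ?X = {} \<or> outside J \<inter> h ` ?X = {}"
        using connectedD[of "h ` ?X" "inside J" "outside J"] jordan by simp
      then have "h ` ?X \<subseteq> inside J" using hp \<open>h ` ?X \<subseteq> inside J \<union> outside J\<close> by blast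
      then have "?X \<subseteq> g ` inside J" using XQ gh by force
      then have "bounded ?X" using jordan bg bounded_subset by blast
      then show "p \<in> D" unfolding D_def bounded_domain_def using p split by blast
    qed
  qed
  have clI: "closure (inside J) = inside J \<union> J"
    using jordan closure_Un_frontier[of "inside J"] by simp
  have clD: "closure D \<subseteq> D \<union> C"
  proof -
    have "closed (g ` closure (inside J))"
      using jordan by (intro compact_imp_closed compact_continuous_image cg) (simp add: compact_closure)
    then have "closure D \<subseteq> g ` closure (inside J)"
      unfolding D_eq using closure_subset by (intro closure_minimal) blast+
    then show ?thesis unfolding clI D_eq using gJ by blast
  qed
  have dis: "g ` inside J \<inter> g ` outside J = {}"
  proof -
    have "inside J \<inter> outside J = {}" using jordan by blast
    moreover have "inj g" using hg by (rule inj_on_inverseI)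
    ultimately show ?thesis by (simp add: image_Int[symmetric])
  qed
  have ext: "g ` outside J \<subseteq> ext_in ?Q D"
    unfolding ext_in_def using clD split dis D_eq by blast
  have far: "\<exists>r\<in>g ` outside J. r$i > b" for b
  proof -
    have "bounded (closure (inside J))" using jordan bounded_closure by blast
    then have "bounded (inside J \<union> J)" unfolding clI .
    then obtain R where R: "\<forall>z\<in>inside J \<union> J. norm z \<le> R" unfolding bounded_iff ..
    define z where "z = complex_of_real (\<bar>R\<bar> + \<bar>b\<bar> + 1)"
    have nz: "norm z = \<bar>R\<bar> + \<bar>b\<bar> + 1" unfolding z_def by (simp only: norm_of_real)
    then have "z \<notin> inside J \<union> J" using R by force
    then have "z \<in> outside J" using inside_Un_outside[of J] by blast
    moreover have "g z $ i > b" unfolding g_def z_def by simp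
    ultimately show ?thesis by blast
  qed
  show ?thesis
    using that[of "g ` outside J" i] con split ext ij(1) far unfolding D_eq by blast
qed

text \<open>For \<open>s = 1\<close> this concerns the region above a highest point, for \<open>s = -1\<close> the region below a lowest
one.\<close>

lemma normal_side_at_extremum:
  assumes nv: "nonvanishing_mean_curvature M" and p: "p \<in> surface_interior M"
    and s: "s * s = 1" and k: "k = 1 \<or> k = 3" and max: "\<And>y. y \<in> M \<Longrightarrow> s * y$k \<le> s * p$k"
    and A: "\<And>y. s * y$k > s * p$k \<Longrightarrow> y \<in> A"
  shows "normal_side M A p"
proof -
  have "p \<in> M" using p unfolding surface_interior_def by blast
  then obtain W N where N: "p \<in> W" "sol_unit_normal_on M W N" "sol_mean_curvature N p \<noteq> 0"
    using nv unfolding nonvanishing_mean_curvature_def by blast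
  let ?n = "sgn (sol_mean_curvature N p) *\<^sub>R N p"
  have n: "s * ?n $ k < 0" using mean_curvature_at_extremum[OF p N max s k] by simp
  have "p - t *\<^sub>R ?n \<in> A" if "t > 0" for t
  proof (rule A)
    have "s * (p - t *\<^sub>R ?n) $ k = s * p$k - t * (s * ?n $ k)" by (simp add: algebra_simps)
    moreover have "t * (s * ?n $ k) < 0" using that n by (rule mult_pos_neg)
    ultimately show "s * (p - t *\<^sub>R ?n) $ k > s * p$k" by linarith
  qed
  then have "\<forall>\<^sub>F t in at_right 0. p - t *\<^sub>R ?n \<in> A"
    unfolding eventually_at_right_field by (intro exI[of _ 1]) simp
  then show ?thesis unfolding normal_side_def using N by blast
qed

lemma surface_on_one_side:
  fixes M :: "(real^3) set"
  assumes emb: "embedded_surface M" and M: "compact M" "connected M"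
    and curve: "simple_closed_curve (surface_boundary M)"
    and nv: "nonvanishing_mean_curvature M" and k: "k = 1 \<or> k = 3"
    and bd: "surface_boundary M \<subseteq> {p. p$k = 0}"
    and ext: "M \<inter> ext_in {p. p$k = 0} (bounded_domain {p. p$k = 0} (surface_boundary M)) = {}"
  shows "M \<subseteq> {p. p$k \<ge> 0} \<or> M \<subseteq> {p. p$k \<le> 0}"
proof (rule ccontr)
  let ?K = "surface_boundary M"
  assume "\<not> ?thesis"
  then obtain y z where yz: "y \<in> M" "y$k < 0" "z \<in> M" "z$k > 0" by force
  have cont: "continuous_on M (\<lambda>x. x$k)" by (intro continuous_intros)
  obtain p where p: "p \<in> M" "\<And>x. x \<in> M \<Longrightarrow> x$k \<le> p$k"
    using continuous_attains_sup[OF M(1) _ cont] yz(1) by blast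
  obtain q where q: "q \<in> M" "\<And>x. x \<in> M \<Longrightarrow> q$k \<le> x$k"
    using continuous_attains_inf[OF M(1) _ cont] yz(1) by blast
  have pos: "p$k > 0" "q$k < 0" using p(2)[OF yz(3)] q(2)[OF yz(1)] yz by linarith+
  have int: "x \<in> surface_interior M" if "x \<in> M" "x \<notin> ?K" for x
    using emb that unfolding embedded_surface_def by blast
  obtain c where c: "path c" "path_image c = ?K"
    using curve simple_path_imp_path unfolding simple_closed_curve_def by blast
  have K: "closed ?K" "?K \<noteq> {}" using c closed_path_image path_image_nonempty by metis+
  obtain T i where T: "connected (bounded_domain {p. p$k = 0} ?K)" "connected T"
    "bounded_domain {p. p$k = 0} ?K \<union> T = {p. p$k = 0} - ?K"
    "T \<subseteq> ext_in {p. p$k = 0} (bounded_domain {p. p$k = 0} ?K)" "i \<noteq> k" "\<And>c. \<exists>r\<in>T. r$i > c"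
    by (rule coordinate_plane_jordan[OF curve bd]) (rule that)
  obtain b where b: "\<And>x. x \<in> M \<Longrightarrow> norm x \<le> b"
    using compact_imp_bounded[OF M(1)] bounded_iff by blast
  obtain r where r: "r \<in> T" "r$i > b" using T(6) by blast
  have "\<exists>U A B. splits M U A B \<and> M - ?K \<subseteq> U \<and> {x. x$k > p$k} \<subseteq> A \<and> {x. x$k < q$k} \<subseteq> B"
  proof (rule splits_opposite_sides[OF compact_imp_closed[OF M(1)] K(1) bd _ T(1-3) _ _ r(1) T(5) r(2)])
    show "two_sided_at M x" if "x \<in> M" "x \<notin> ?K" for x
      using interior_two_sided[OF int[OF that]] .
    show "M \<inter> T = {}" using ext T(4) by blast
    show "\<not> splits M U A B" if "- ?K \<subseteq> U" for U A B using boundary_essential[OF K(2) that] .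
    show "x$i \<le> b" if "x \<in> M" for x
      using b[OF that] component_le_norm_cart[of x i] by linarith
  qed (use p q pos in auto)
  then obtain U A B where spl: "splits M U A B" and U: "M - ?K \<subseteq> U"
    and AB: "{x. x$k > p$k} \<subseteq> A" "{x. x$k < q$k} \<subseteq> B" by blast
  have pK: "p \<in> M - ?K" "q \<in> M - ?K" using p q pos bd by auto
  have "normal_side M A p"
    by (rule normal_side_at_extremum[OF nv _ _ k, where s = 1]) (use int pK p AB in auto)
  moreover have "normal_side M B q"
    by (rule normal_side_at_extremum[OF nv _ _ k, where s = "-1"]) (use int pK q AB in auto)
  moreover have "(\<forall>x\<in>M - ?K. normal_side M A x) \<or> (\<forall>x\<in>M - ?K. normal_side M B x)"
    by (rule normal_side_constant[OF nv spl connected_minus_surface_boundary[OF M(2)] _ U]) (use int in blast)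
  ultimately show False
    using normal_side_exclusive[OF _ splitsD(4)[OF spl]] int pK by blast
qed

theorem theorem3p3:
  fixes M :: "(real^3) set"
  assumes "embedded_surface M" and "compact M" and "connected M"
    and "simple_closed_curve (surface_boundary M)"
    and "nonvanishing_mean_curvature M"
  shows "(surface_boundary M \<subseteq> plane_P \<and>
           M \<inter> ext_in plane_P (bounded_domain plane_P (surface_boundary M)) = {} \<longrightarrow>
           M \<subseteq> {p. p$1 \<ge> 0} \<or> M \<subseteq> {p. p$1 \<le> 0}) \<and>
         (surface_boundary M \<subseteq> plane_R \<and>
           M \<inter> ext_in plane_R (bounded_domain plane_R (surface_boundary M)) = {} \<longrightarrow>
           M \<subseteq> {p. p$3 \<ge> 0} \<or> M \<subseteq> {p. p$3 \<le> 0})"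
  unfolding plane_P_def plane_R_def
  using surface_on_one_side[OF assms, of 1] surface_on_one_side[OF assms, of 3] by blast

end
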